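(* In the setting of the context (GSVD of $(A,B)$, approximate spectral projector $P$, subspace iteration with dimension $p\ge n_{gv}$), suppose $\gamma_p>\gamma_{p+1}$ and $X_p^THX^{(0)}$ is nonsingular. Then for every $k\ge0$, $$\hat X^{(k)}=(X_p+X_{p,\perp}E^{(k)})(M^{(k)})^{-1/2}W^{(k)},$$ where $E^{(k)}=\Gamma_p'^{\,k}X_{p,\perp}^THX^{(0)}(X_p^THX^{(0)})^{-1}\Gamma_p^{-k}$, $M^{(k)}=I+(E^{(k)})^TE^{(k)}$, and $W^{(k)}$ is an orthogonal matrix; moreover $$\|E^{(k)}\|\le\Bigl(\frac{\gamma_{p+1}}{\gamma_p}\Bigr)^k\|E^{(0)}\|,$$ and the distance $\epsilon^{(k)}=\|X_{p,\perp}^TH\hat X^{(k)}\|$ between $\mathcal X^{(k)}$ and $\mathrm{span}\{X_p\}$ satisfies $$\epsilon^{(k)}=\frac{\|E^{(k)}\|}{\sqrt{1+\|E^{(k)}\|^2}}\le\Bigl(\frac{\gamma_{p+1}}{\gamma_p}\Bigr)^k\|E^{(0)}\|.$$ Label the Ritz quintuples $(\hat c_i^{(k)},\hat s_i^{(k)},\hat u_i^{(k)},\hat v_i^{(k)},\hat x_i^{(k)})$, $i=1,\dots,n_{gv}$, so that $\hat c_1^{(k)},\dots,\hat c_{n_{gv}}^{(k)}$ are in the same order as $c_1,\dots,c_{n_{gv}}$, and let $\hat\sigma_i^{(k)}=\hat c_i^{(k)}/\hat s_i^{(k)}$, $\sigma_i=c_i/s_i$. Then $$\chi\bigl((\hat\sigma_i^{(k)})^2,\sigma_i^2\bigr)\le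 6(\epsilon^{(k)})^2+2(\epsilon^{(k)})^4,\qquad i=1,\dots,n_{gv}.$$
   Context: $A\in\mathbb{R}^{m_1\times n}$, $B\in\mathbb{R}^{m_2\times n}$, $m_1+m_2\ge n$, $[A^T,B^T]^T$ of full column rank; $H=A^TA+B^TB$. GSVD: $U^TAX=\Sigma_A$, $V^TBX=\Sigma_B$ with $X=[x_1,\dots,x_n]$ nonsingular, $X^THX=I$, $U,V$ orthogonal, $\Sigma_A^T\Sigma_A=\mathrm{diag}(c_1^2,\dots,c_n^2)$, $\Sigma_B^T\Sigma_B=\mathrm{diag}(s_1^2,\dots,s_n^2)$, $c_i,s_i\ge0$, $c_i^2+s_i^2=1$. $S=H^{-1}(A^TA-B^TB)$. Given $[c_{\min},c_{\max}]\subset[0,1]$ and degree $d$, let $l(z)=2z^2-1$, $\alpha=\arccos(l(c_{\min}))$, $\beta=\arccos(l(c_{\max}))$, $\eta_0=(\alpha-\beta)/\pi$, $\eta_j=2(\sin(j\alpha)-\sin(j\beta))/(j\pi)$, $\rho_{j,d}=\frac{(d+2-j)\sin\frac{\pi}{d+2}\cos\frac{j\pi}{d+2}+\cos\frac{\pi}{d+2}\sin\frac{j\pi}{d+2}}{(d+2)\sin\frac{\pi}{d+2}}$, $\psi_d(x)=\sum_{j=0}^d\rho_{j,d}\eta_jT_j(x)$ ($T_j$ Chebyshev polynomials), $P=\psi_d(S)=X\,\psi_d(2\Sigma_A^T\Sigma_A-I)X^{-1}$, with eigenvalues $\gamma_i=\psi_d(l(c_i))$ and $Px_i=\gamma_ix_i$.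 Indexing: $c_1,\dots,c_r\in(c_{\min},c_{\max})$, $c_{r+1},\dots,c_{n_{gv}}\in\{c_{\min},c_{\max}\}$, $c_{n_{gv}+1},\dots,c_n\notin[c_{\min},c_{\max}]$, with $\gamma_i$ decreasing within each of these three index groups. Let $p\ge n_{gv}$, $X_p=[x_1,\dots,x_p]$, $X_{p,\perp}=[x_{p+1},\dots,x_n]$, $\Gamma_p=\mathrm{diag}(\gamma_1,\dots,\gamma_p)$, $\Gamma_p'=\mathrm{diag}(\gamma_{p+1},\dots,\gamma_n)$. Algorithm (subspace iteration with GSVD projection): start with $X^{(0)}\in\mathbb{R}^{n\times p}$ of full column rank. At iteration $k=0,1,\dots$: take thin QR factorizations $X^{(k)}=Q^{(k)}R^{(k)}$, $AQ^{(k)}=Q_1^{(k)}\bar A^{(k)}$, $BQ^{(k)}=Q_2^{(k)}\bar B^{(k)}$ (assuming $AQ^{(k)},BQ^{(k)}$ have full column rank); compute the GSVD of the $p\times p$ pair $\bar A^{(k)}=\bar U^{(k)}\hat\Sigma_A^{(k)}(\bar X^{(k)})^{-1}$, $\bar B^{(k)}=\bar V^{(k)}\hat\Sigma_B^{(k)}(\bar X^{(k)})^{-1}$ with $\hat\Sigma_A^{(k)}=\mathrm{diag}(\hat c_1^{(k)},\dots,\hat c_p^{(k)})$, $\hat\Sigma_B^{(k)}=\mathrm{diag}(\hat s_1^{(k)},\dots,\hat s_p^{(k)})$, $(\hat c_i^{(k)})^2+(\hat s_i^{(k)})^2=1$; set $\hat X^{(k)}=Q^{(k)}\bar X^{(k)}$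 ($H$-orthonormal), $\hat U^{(k)}=Q_1^{(k)}\bar U^{(k)}$, $\hat V^{(k)}=Q_2^{(k)}\bar V^{(k)}$, Ritz quintuples $(\hat c_i^{(k)},\hat s_i^{(k)},\hat U^{(k)}e_i,\hat V^{(k)}e_i,\hat X^{(k)}e_i)$; then $X^{(k+1)}=P\hat X^{(k)}$. $\mathcal X^{(k)}=\mathrm{span}\{\hat X^{(k)}\}$. Chordal metric: $\chi(\lambda,\mu)=|\lambda-\mu|/(\sqrt{1+|\lambda|^2}\sqrt{1+|\mu|^2})$.
   Formalization: It is additionally assumed that γ_p is the smallest of γ_1,…,γ_p; with γ_i decreasing only within each of the three groups, the bound ‖E^(k)‖ ≤ (γ_{p+1}/γ_p)^k‖E^(0)‖ can fail (e.g. d=1, p=n_gv+1, c_p>c_max, c_{p+1}<c_min). *)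

theory Defs
  imports "HOL-Analysis.Analysis" "Jordan_Normal_Form.Matrix" "Jordan_Normal_Form.Gauss_Jordan_Elimination"
begin

text \<open>Matrices are Jordan_Normal_Form matrices over the reals; all indices are 0-based.\<close>

definition minv :: "real mat \<Rightarrow> real mat" where
  "minv M = (SOME B. inverts_mat M B \<and> inverts_mat B M)"

definition orthonormal_cols :: "real mat \<Rightarrow> bool" where
  "orthonormal_cols Q \<longleftrightarrow> transpose_mat Q * Q = 1\<^sub>m (dim_col Q)"

definition full_col_rank :: "real mat \<Rightarrow> bool" where
  "full_col_rank M \<longleftrightarrow> (\<forall>v \<in> carrier_vec (dim_col M). M *\<^sub>v v = 0\<^sub>v (dim_row M) \<longrightarrow> v = 0\<^sub>v (dim_col M))"

definition sym_pos_def :: "real mat \<Rightarrow> bool" where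
  "sym_pos_def N \<longleftrightarrow> square_mat N \<and> transpose_mat N = N \<and>
     (\<forall>v \<in> carrier_vec (dim_col N). v \<noteq> 0\<^sub>v (dim_col N) \<longrightarrow> v \<bullet> (N *\<^sub>v v) > 0)"

definition vnorm :: "real vec \<Rightarrow> real" where
  "vnorm v = sqrt (v \<bullet> v)"

definition mnorm :: "real mat \<Rightarrow> real" where
  "mnorm M = Sup {vnorm (M *\<^sub>v v) | v. v \<in> carrier_vec (dim_col M) \<and> vnorm v \<le> 1}"

definition diagm :: "nat \<Rightarrow> (nat \<Rightarrow> real) \<Rightarrow> real mat" where
  "diagm n f = mat n n (\<lambda>(i,j). if i = j then f i else 0)"

definition cols_first :: "nat \<Rightarrow> real mat \<Rightarrow> real mat" where
  "cols_first p X = mat (dim_row X) p (\<lambda>(i,j). X $$ (i,j))"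
definition cols_rest :: "nat \<Rightarrow> real mat \<Rightarrow> real mat" where
  "cols_rest p X = mat (dim_row X) (dim_col X - p) (\<lambda>(i,j). X $$ (i,j+p))"

fun cheb :: "nat \<Rightarrow> real \<Rightarrow> real" where
  "cheb 0 x = 1"
| "cheb (Suc 0) x = x"
| "cheb (Suc (Suc j)) x = 2 * x * cheb (Suc j) x - cheb j x"

fun cheb_mat :: "nat \<Rightarrow> real mat \<Rightarrow> real mat" where
  "cheb_mat 0 M = 1\<^sub>m (dim_row M)"
| "cheb_mat (Suc 0) M = M"
| "cheb_mat (Suc (Suc j)) M = 2 \<cdot>\<^sub>m (M * cheb_mat (Suc j) M) - cheb_mat j M"

definition lmap :: "real \<Rightarrow> real" where "lmap z = 2 * z\<^sup>2 - 1"

definition eta :: "real \<Rightarrow> real \<Rightarrow> nat \<Rightarrow> real" where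
  "eta cmin cmax j =
     (let \<alpha> = arccos (lmap cmin); \<beta> = arccos (lmap cmax) in
      if j = 0 then (\<alpha> - \<beta>) / pi
      else 2 * (sin (real j * \<alpha>) - sin (real j * \<beta>)) / (real j * pi))"

definition rho :: "nat \<Rightarrow> nat \<Rightarrow> real" where
  "rho j d =
    ((real (d + 2) - real j) * sin (pi / real (d+2)) * cos (real j * pi / real (d+2))
      + cos (pi / real (d+2)) * sin (real j * pi / real (d+2)))
    / (real (d+2) * sin (pi / real (d+2)))"

definition psi :: "nat \<Rightarrow> real \<Rightarrow> real \<Rightarrow> real \<Rightarrow> real" where
  "psi d cmin cmax x = (\<Sum>j\<le>d. rho j d * eta cmin cmax j * cheb j x)"

definition psi_mat :: "nat \<Rightarrow> real \<Rightarrow> real \<Rightarrow> real mat \<Rightarrow> real mat" where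
  "psi_mat d cmin cmax S =
     foldr (\<lambda>j acc. acc + (rho j d * eta cmin cmax j) \<cdot>\<^sub>m cheb_mat j S) [0..<Suc d]
       (0\<^sub>m (dim_row S) (dim_row S))"

text \<open>Squared generalized singular value (c/s)^2 as an extended real (infinite when s = 0),
  and the chordal metric on the nonnegative extended reals.\<close>
definition sqratio :: "real \<Rightarrow> real \<Rightarrow> ereal" where
  "sqratio c s = (if s = 0 then \<infinity> else ereal ((c / s)\<^sup>2))"

definition chordal :: "real \<Rightarrow> real \<Rightarrow> real" where
  "chordal l m = \<bar>l - m\<bar> / (sqrt (1 + l\<^sup>2) * sqrt (1 + m\<^sup>2))"

definition chordal_e :: "ereal \<Rightarrow> ereal \<Rightarrow> real" where
  "chordal_e x y =
    (if x = \<infinity> \<and> y = \<infinity> then 0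
     else if x = \<infinity> then 1 / sqrt (1 + (real_of_ereal y)\<^sup>2)
     else if y = \<infinity> then 1 / sqrt (1 + (real_of_ereal x)\<^sup>2)
     else chordal (real_of_ereal x) (real_of_ereal y))"

end

theory Submission
  imports Defs "Jordan_Normal_Form.Spectral_Radius"
begin

text \<open>
  The Jackson coefficients are the autocorrelations of a finite sequence, so the Jackson kernel is
  nonnegative and with it the filter values \<open>\<gamma> i\<close>; hence the gap makes the first \<open>p\<close> of them
  positive and bounds the remaining ones in absolute value by \<open>\<gamma> p\<close>. In the coordinates given by the
  columns of \<open>X\<close>, every iterate spans the graph of \<open>E k\<close>, because one step multiplies the two
  coordinate blocks by diagonal matrices. Orthonormality of the Ritz basis then says that its
  coordinate blocks \<open>T\<close> and \<open>F = E k * T\<close> satisfy \<open>T\<^sup>T T + F\<^sup>T F = I\<close>, which gives the polar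
  factorization and the formula for \<open>eps\<close>. The quadratic forms of the Ritz values at \<open>v\<close> and of the
  leading \<open>c\<^sup>2\<close> at \<open>T v\<close> differ by at most \<open>|F v|\<^sup>2 \<le> eps\<^sup>2 |v|\<^sup>2\<close>, so a dimension count as in the
  Courant--Fischer theorem bounds \<open>|ch\<^sup>2 - c\<^sup>2|\<close> by \<open>eps\<^sup>2\<close>, and the chordal distance is at most
  twice that.
\<close>

unbundle no vec_syntax
unbundle no inner_syntax

section \<open>Nonnegativity of the Jackson--Chebyshev filter\<close>

lemma cheb_cos: "cheb j (cos t) = cos (real j * t)"
proof (induction j "cos t" rule: cheb.induct)
  case (3 j)
  have "cos (real (Suc (Suc j)) * t) + cos (real j * t) = 2 * cos t * cos (real (Suc j) * t)"
    using cos_add[of "real (Suc j) * t" t] cos_diff[of "real (Suc j) * t" t]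
    by (simp add: algebra_simps)
  with 3 show ?case by (simp add: algebra_simps)
qed simp_all

definition autocorrelation :: "nat \<Rightarrow> (nat \<Rightarrow> real) \<Rightarrow> nat \<Rightarrow> real" where
  "autocorrelation m a j = (\<Sum>k<m - j. a k * a (k + j))"

lemma autocorrelation_0: "autocorrelation m a 0 = (\<Sum>k<m. (a k)\<^sup>2)"
  by (simp add: autocorrelation_def power2_eq_square)

lemma autocorrelation_Suc:
  "j \<le> m \<Longrightarrow> autocorrelation (Suc m) a j = autocorrelation m a j + a (m - j) * a m"
  by (simp add: autocorrelation_def Suc_diff_le)

lemma autocorrelation_beyond: "m \<le> j \<Longrightarrow> autocorrelation m a j = 0"
  by (simp add: autocorrelation_def)

lemma trig_sum_projection:
  fixes a :: "nat \<Rightarrow> real"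
  shows "(\<Sum>k<m. a k * cos (real k * t)) * cos (real m * t)
      + (\<Sum>k<m. a k * sin (real k * t)) * sin (real m * t)
    = (\<Sum>j=1..m. a (m - j) * cos (real j * t))"
proof -
  have "(\<Sum>k<m. a k * cos (real k * t)) * cos (real m * t)
      + (\<Sum>k<m. a k * sin (real k * t)) * sin (real m * t)
    = (\<Sum>k<m. a k * cos (real k * t) * cos (real m * t) + a k * sin (real k * t) * sin (real m * t))"
    by (simp only: sum_distrib_right sum.distrib)
  also have "\<dots> = (\<Sum>k<m. a k * cos ((real m - real k) * t))"
    by (rule sum.cong) (simp_all add: left_diff_distrib cos_diff algebra_simps)
  also have "\<dots> = (\<Sum>j=1..m. a (m - j) * cos (real j * t))"
    by (rule sum.reindex_bij_witness[of _ "\<lambda>j. m - j" "\<lambda>k. m - k"]) (auto simp: of_nat_diff)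
  finally show ?thesis .
qed

lemma power2_norm_trig_sum:
  fixes a :: "nat \<Rightarrow> real"
  shows "(\<Sum>k<m. a k * cos (real k * t))\<^sup>2 + (\<Sum>k<m. a k * sin (real k * t))\<^sup>2
    = autocorrelation m a 0 + 2 * (\<Sum>j=1..m. autocorrelation m a j * cos (real j * t))"
proof (induction m)
  case 0
  then show ?case by (simp add: autocorrelation_def)
next
  case (Suc m)
  let ?C = "\<Sum>k<m. a k * cos (real k * t)" and ?S = "\<Sum>k<m. a k * sin (real k * t)"
  have expand: "(C + b * x)\<^sup>2 + (S + b * y)\<^sup>2
      = (C\<^sup>2 + S\<^sup>2) + 2 * b * (C * x + S * y) + b\<^sup>2 * (y\<^sup>2 + x\<^sup>2)" for C S b x y :: real
    by (simp add: power2_eq_square algebra_simps)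
  have "(?C + a m * cos (real m * t))\<^sup>2 + (?S + a m * sin (real m * t))\<^sup>2
    = (?C\<^sup>2 + ?S\<^sup>2) + 2 * a m * (?C * cos (real m * t) + ?S * sin (real m * t))
      + (a m)\<^sup>2 * ((sin (real m * t))\<^sup>2 + (cos (real m * t))\<^sup>2)"
    by (rule expand)
  also have "\<dots> = autocorrelation (Suc m) a 0
      + 2 * ((\<Sum>j=1..m. autocorrelation m a j * cos (real j * t))
        + a m * (\<Sum>j=1..m. a (m - j) * cos (real j * t)))"
    unfolding Suc.IH trig_sum_projection by (simp add: autocorrelation_0 algebra_simps)
  also have "(\<Sum>j=1..m. autocorrelation m a j * cos (real j * t))
      + a m * (\<Sum>j=1..m. a (m - j) * cos (real j * t))
    = (\<Sum>j=1..Suc m. autocorrelation (Suc m) a j * cos (real j * t))"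
    by (simp add: autocorrelation_Suc autocorrelation_beyond sum_distrib_left distrib_left
        distrib_right sum.distrib mult_ac)
  finally show ?case by simp
qed

lemma sin_mult_sum_cos:
  fixes x y :: real
  shows "sin x * (\<Sum>k<n. cos (2 * real k * x + y)) = sin (real n * x) * cos ((real n - 1) * x + y)"
proof (induction n)
  case (Suc n)
  have product_to_sum: "2 * sin a * cos b = sin (a + b) + sin (a - b)" for a b :: real
    by (simp add: sin_add sin_diff)
  have "2 * (sin x * (\<Sum>k<Suc n. cos (2 * real k * x + y)))
    = 2 * sin (real n * x) * cos ((real n - 1) * x + y) + 2 * sin x * cos (2 * real n * x + y)"
    using Suc by (simp add: algebra_simps)
  also have "\<dots> = 2 * sin (real (Suc n) * x) * cos ((real (Suc n) - 1) * x + y)"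
    unfolding product_to_sum using sin_minus[of "x - (2 * real n * x + y)"]
    by (simp add: algebra_simps)
  finally show ?case by simp
qed simp

lemma autocorrelation_sin:
  fixes x :: real
  assumes j: "j \<le> m" and period: "real m * x = pi" and "sin x \<noteq> 0"
  shows "autocorrelation m (\<lambda>k. sin (real k * x)) j
    = ((real m - real j) * sin x * cos (real j * x) + cos x * sin (real j * x)) / (2 * sin x)"
proof -
  have product_to_sum: "sin (real k * x) * sin (real (k + j) * x)
      = (cos (real j * x) - cos (2 * real k * x + real j * x)) / 2" for k
    using cos_add[of "real k * x" "real (k + j) * x"] cos_diff[of "real (k + j) * x" "real k * x"]
    by (simp add: algebra_simps)
  have "autocorrelation m (\<lambda>k. sin (real k * x)) j
      = (real (m - j) * cos (real j * x) - (\<Sum>k<m - j. cos (2 * real k * x + real j * x))) / 2"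
    unfolding autocorrelation_def product_to_sum
    by (simp add: sum_subtractf flip: sum_divide_distrib)
  also have "(\<Sum>k<m - j. cos (2 * real k * x + real j * x)) = - sin (real j * x) * cos x / sin x"
  proof -
    have "real (m - j) * x = pi - real j * x" "(real (m - j) - 1) * x + real j * x = pi - x"
      using j period by (simp_all add: of_nat_diff algebra_simps)
    then have "sin x * (\<Sum>k<m - j. cos (2 * real k * x + real j * x)) = - sin (real j * x) * cos x"
      unfolding sin_mult_sum_cos by simp
    then show ?thesis using \<open>sin x \<noteq> 0\<close> by (metis eq_divide_imp mult.commute)
  qed
  finally show ?thesis
    using j \<open>sin x \<noteq> 0\<close> by (simp add: of_nat_diff field_simps)
qed

lemma sin_pi_div_pos: "1 < m \<Longrightarrow> 0 < sin (pi / real m)"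
  by (intro sin_gt_zero) (auto simp: field_simps)

lemma rho_autocorrelation:
  assumes m: "m = d + 2" and j: "j \<le> m" and x: "x = pi / real m"
  shows "autocorrelation m (\<lambda>k. sin (real k * x)) j = real m / 2 * rho j d"
proof -
  have "0 < m" by (simp add: m)
  have "0 < sin x" unfolding x by (rule sin_pi_div_pos) (simp add: m)
  moreover from \<open>0 < m\<close> have "real m * x = pi" "real j * pi / real m = real j * x"
    by (simp_all add: x)
  ultimately show ?thesis
    using j \<open>0 < m\<close> unfolding rho_def m[symmetric] x[symmetric]
    by (subst autocorrelation_sin) simp_all
qed

definition jackson_kernel :: "nat \<Rightarrow> real \<Rightarrow> real" where
  "jackson_kernel d t = 1 + 2 * (\<Sum>j=1..d. rho j d * cos (real j * t))"

lemma rho_0 [simp]: "rho 0 d = 1"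
  using sin_pi_div_pos[of "d + 2"] by (simp add: rho_def)

lemma jackson_kernel_nonneg: "0 \<le> jackson_kernel d t"
proof -
  define m where "m = d + 2"
  define a where "a k = sin (real k * (pi / real m))" for k
  have rho: "autocorrelation m a j = real m / 2 * rho j d" if "j \<le> m" for j
    unfolding a_def by (rule rho_autocorrelation[OF m_def that refl])
  have le_m: "j \<le> m" if "j \<le> d" for j
    using that by (simp add: m_def)
  have vanish: "autocorrelation m a j = 0" if "j \<in> {1..m} - {1..d}" for j
  proof -
    from that have "j = d + 1 \<or> j = d + 2" by (auto simp: m_def)
    then show ?thesis by (auto simp: autocorrelation_def a_def m_def)
  qed
  have "0 \<le> autocorrelation m a 0 + 2 * (\<Sum>j=1..m. autocorrelation m a j * cos (real j * t))"
    unfolding power2_norm_trig_sum[symmetric] by simp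
  also have "(\<Sum>j=1..m. autocorrelation m a j * cos (real j * t))
      = (\<Sum>j=1..d. real m / 2 * rho j d * cos (real j * t))"
    by (rule sum.mono_neutral_cong_right) (auto simp: vanish rho le_m)
  also have "autocorrelation m a 0 + 2 * \<dots> = real m / 2 * jackson_kernel d t"
    by (simp add: rho jackson_kernel_def algebra_simps sum_distrib_left)
  finally show ?thesis by (simp add: m_def zero_le_mult_iff)
qed

text \<open>In the variable \<open>x = cos t\<close>, the polynomial \<open>psi\<close> is the convolution of the indicator function
  of the filter interval with the Jackson kernel; this is an antiderivative of the integrand.\<close>
definition jackson_primitive :: "nat \<Rightarrow> real \<Rightarrow> real \<Rightarrow> real" where
  "jackson_primitive d t u
    = (u + (\<Sum>j=1..d. rho j d * (2 * sin (real j * u) / real j) * cos (real j * t))) / pi"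

lemma jackson_primitive_derivative:
  "(jackson_primitive d t has_real_derivative
    (jackson_kernel d (t - u) + jackson_kernel d (t + u)) / (2 * pi)) (at u)"
proof -
  have "(jackson_primitive d t has_real_derivative
      (1 + (\<Sum>j=1..d. rho j d * (2 * cos (real j * u)) * cos (real j * t))) / pi) (at u)"
    unfolding jackson_primitive_def by (auto intro!: derivative_eq_intros sum.cong)
  moreover
  have "rho j d * (2 * cos (real j * u)) * cos (real j * t)
      = rho j d * cos (real j * (t - u)) + rho j d * cos (real j * (t + u))" for j
    by (simp add: algebra_simps cos_add cos_diff)
  then have "jackson_kernel d (t - u) + jackson_kernel d (t + u)
      = 2 * (1 + (\<Sum>j=1..d. rho j d * (2 * cos (real j * u)) * cos (real j * t)))"
    by (simp add: jackson_kernel_def sum.distrib)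
  ultimately show ?thesis
    by (simp only: mult_divide_mult_cancel_left numeral_neq_zero not_False_eq_True)
qed

lemma psi_eq_jackson_primitive_diff:
  "psi d cmin cmax (cos t)
    = jackson_primitive d t (arccos (lmap cmin)) - jackson_primitive d t (arccos (lmap cmax))"
proof -
  let ?F = "\<lambda>c j. rho j d * (2 * sin (real j * arccos (lmap c)) / real j) * cos (real j * t)"
  have "{..d} = insert 0 {1..d}" by auto
  then have "psi d cmin cmax (cos t)
      = eta cmin cmax 0 + (\<Sum>j=1..d. rho j d * eta cmin cmax j * cos (real j * t))"
    by (simp add: psi_def cheb_cos)
  also have "(\<Sum>j=1..d. rho j d * eta cmin cmax j * cos (real j * t))
      = (\<Sum>j=1..d. (?F cmin j - ?F cmax j) / pi)"
    by (rule sum.cong) (auto simp: eta_def Let_def field_simps)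
  also have "eta cmin cmax 0 + \<dots>
      = jackson_primitive d t (arccos (lmap cmin)) - jackson_primitive d t (arccos (lmap cmax))"
    by (simp add: jackson_primitive_def eta_def sum_subtractf diff_divide_distrib add_divide_distrib
        sum_divide_distrib)
  finally show ?thesis .
qed

lemma lmap_mono: "0 \<le> x \<Longrightarrow> x \<le> y \<Longrightarrow> lmap x \<le> lmap y"
  by (simp add: lmap_def power_mono)

lemma abs_lmap_le_1: "\<bar>x\<bar> \<le> 1 \<Longrightarrow> \<bar>lmap x\<bar> \<le> 1"
  by (simp add: lmap_def abs_le_iff abs_square_le_1)

lemma psi_nonneg:
  assumes "0 \<le> cmin" "cmin \<le> cmax" "cmax \<le> 1" and "\<bar>x\<bar> \<le> 1"
  shows "0 \<le> psi d cmin cmax x"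
proof -
  let ?G = "jackson_primitive d (arccos x)"
  have "arccos (lmap cmax) \<le> arccos (lmap cmin)"
    using assms lmap_mono[of cmin cmax] abs_lmap_le_1[of cmin] abs_lmap_le_1[of cmax]
    by (intro arccos_le_arccos) auto
  then have "?G (arccos (lmap cmax)) \<le> ?G (arccos (lmap cmin))"
  proof (rule DERIV_nonneg_imp_nondecreasing)
    show "\<exists>y. (?G has_real_derivative y) (at u) \<and> 0 \<le> y" for u
      by (intro exI conjI, rule jackson_primitive_derivative) (simp add: jackson_kernel_nonneg)
  qed
  then show ?thesis
    using psi_eq_jackson_primitive_diff[of d cmin cmax "arccos x"] \<open>\<bar>x\<bar> \<le> 1\<close>
    by (simp add: cos_arccos_abs)
qed

section \<open>Vectors and matrices\<close>

lemma assoc_mult_mat_dim: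
  fixes A B C :: "'a :: semiring_0 mat"
  shows "dim_col A = dim_row B \<Longrightarrow> dim_col B = dim_row C \<Longrightarrow> A * B * C = A * (B * C)"
  by (rule assoc_mult_mat[of A "dim_row A" "dim_row B" B "dim_row C" C "dim_col C"]) auto

lemma mult_add_distrib_mat_dim:
  fixes A B C :: "'a :: semiring_0 mat"
  shows "dim_col A = dim_row B \<Longrightarrow> dim_row B = dim_row C \<Longrightarrow> dim_col B = dim_col C
    \<Longrightarrow> A * (B + C) = A * B + A * C"
  by (rule mult_add_distrib_mat[of A "dim_row A" "dim_row B" B "dim_col B" C]) auto

lemma add_mult_distrib_mat_dim:
  fixes A B C :: "'a :: semiring_0 mat"
  shows "dim_col A = dim_row C \<Longrightarrow> dim_row A = dim_row B \<Longrightarrow> dim_col A = dim_col B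
    \<Longrightarrow> (A + B) * C = A * C + B * C"
  by (rule add_mult_distrib_mat[of A "dim_row A" "dim_col A" B C "dim_col C"]) auto

lemma transpose_mult_dim:
  fixes A B :: "'a :: comm_semiring_0 mat"
  shows "dim_col A = dim_row B \<Longrightarrow> (A * B)\<^sup>T = B\<^sup>T * A\<^sup>T"
  by (rule transpose_mult[of A "dim_row A" "dim_row B" B "dim_col B"]) auto

lemma assoc_mult_mat_vec_dim:
  fixes A B :: "'a :: semiring_0 mat"
  shows "dim_col A = dim_row B \<Longrightarrow> dim_col B = dim_vec v \<Longrightarrow> A * B *\<^sub>v v = A *\<^sub>v (B *\<^sub>v v)"
  by (rule assoc_mult_mat_vec[of A "dim_row A" "dim_row B" B "dim_vec v" v])
    (auto intro: carrier_vecI)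

lemma scalar_prod_transpose_mult_mat_vec_dim:
  fixes A :: "'a :: comm_semiring_0 mat"
  shows "dim_col A = dim_vec u \<Longrightarrow> dim_row A = dim_vec v \<Longrightarrow> u \<bullet> (A\<^sup>T *\<^sub>v v) = (A *\<^sub>v u) \<bullet> v"
  by (rule transpose_vec_mult_scalar[of "A\<^sup>T" "dim_vec u" "dim_vec v", simplified, symmetric])
    (auto intro: carrier_vecI carrier_matI)

lemma mult_mat_zero_vec [simp]:
  fixes A :: "'a :: semiring_0 mat"
  shows "dim_col A = n \<Longrightarrow> A *\<^sub>v 0\<^sub>v n = 0\<^sub>v (dim_row A)"
  by (auto intro!: eq_vecI simp: scalar_prod_def)

lemma scalar_prod_self: "v \<bullet> v = (\<Sum>i<dim_vec v. (v $ i)\<^sup>2)" for v :: "real vec"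
  by (simp add: scalar_prod_def power2_eq_square atLeast0LessThan)

lemma scalar_prod_self_ge_0 [simp]: "0 \<le> v \<bullet> v" for v :: "real vec"
  using conjugate_square_ge_0_vec[of v] by simp

lemma scalar_prod_self_pos_iff: "v \<in> carrier_vec n \<Longrightarrow> 0 < v \<bullet> v \<longleftrightarrow> v \<noteq> 0\<^sub>v n" for v :: "real vec"
  using conjugate_square_greater_0_vec[of v n] by simp

lemma diagm_eq_mat_diag: "diagm n f = mat_diag n f"
  by (auto simp: diagm_def mat_diag_def)

lemma diagm_carrier [simp]: "diagm n f \<in> carrier_mat n n"
  by (simp add: diagm_def)

lemma diagm_dim [simp]: "dim_row (diagm n f) = n" "dim_col (diagm n f) = n"
  by (simp_all add: diagm_def)

lemma diagm_index [simp]: "i < n \<Longrightarrow> j < n \<Longrightarrow> diagm n f $$ (i, j) = (if i = j then f i else 0)"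
  by (simp add: diagm_def)

lemma transpose_diagm [simp]: "(diagm n f)\<^sup>T = diagm n f"
  by (rule eq_matI) auto

lemma mult_diagm_index:
  "A \<in> carrier_mat m n \<Longrightarrow> i < m \<Longrightarrow> j < n \<Longrightarrow> (A * diagm n f) $$ (i, j) = A $$ (i, j) * f j"
  by (simp add: diagm_eq_mat_diag mat_diag_mult_right)

lemma diagm_mult_diagm: "diagm n f * diagm n g = diagm n (\<lambda>i. f i * g i)"
  by (simp add: diagm_eq_mat_diag)

lemma diagm_add: "diagm n f + diagm n g = diagm n (\<lambda>i. f i + g i)"
  by (rule eq_matI) auto

lemma diagm_minus: "diagm n f - diagm n g = diagm n (\<lambda>i. f i - g i)"
  by (rule eq_matI) auto

lemma diagm_cong: "(\<And>i. i < n \<Longrightarrow> f i = g i) \<Longrightarrow> diagm n f = diagm n g"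
  by (rule eq_matI) auto

lemma diagm_one [simp]: "diagm n (\<lambda>_. 1) = 1\<^sub>m n"
  by (rule eq_matI) auto

lemma diagm_mult_vec_index:
  "v \<in> carrier_vec n \<Longrightarrow> i < n \<Longrightarrow> (diagm n f *\<^sub>v v) $ i = f i * v $ i"
  by (simp add: scalar_prod_def if_distrib[of "\<lambda>x. x * _"] sum.delta cong: if_cong)

lemma scalar_prod_diagm:
  "v \<in> carrier_vec n \<Longrightarrow> v \<bullet> (diagm n f *\<^sub>v v) = (\<Sum>i<n. f i * (v $ i)\<^sup>2)"
  by (simp add: scalar_prod_def[of v] diagm_mult_vec_index power2_eq_square atLeast0LessThan mult_ac
      del: index_mult_mat_vec)

lemma minv_inverse:
  assumes M: "M \<in> carrier_mat n n" and inv: "invertible_mat M"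
  shows "minv M \<in> carrier_mat n n" "M * minv M = 1\<^sub>m n" "minv M * M = 1\<^sub>m n"
proof -
  have "\<exists>B. inverts_mat M B \<and> inverts_mat B M" using inv by (auto simp: invertible_mat_def)
  then have "inverts_mat M (minv M) \<and> inverts_mat (minv M) M"
    unfolding minv_def by (rule someI_ex)
  then have right: "M * minv M = 1\<^sub>m n" and left: "minv M * M = 1\<^sub>m (dim_row (minv M))"
    using M by (auto simp: inverts_mat_def)
  moreover have "dim_col (minv M) = n" using arg_cong[OF right, of dim_col] by simp
  moreover have "dim_row (minv M) = n" using arg_cong[OF left, of dim_col] M by simp
  ultimately show "minv M \<in> carrier_mat n n" "M * minv M = 1\<^sub>m n" "minv M * M = 1\<^sub>m n"
    by auto
qed

lemma invertible_mat_right_inverse: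
  fixes M B :: "'a :: field mat"
  assumes "M \<in> carrier_mat n n" "B \<in> carrier_mat n n" "M * B = 1\<^sub>m n"
  shows "invertible_mat M"
  using assms mat_mult_left_right_inverse[OF assms]
  by (auto simp: invertible_mat_def inverts_mat_def intro!: exI[of _ B])

lemma invertible_mat_mult:
  fixes M N :: "real mat"
  assumes M: "M \<in> carrier_mat n n" "invertible_mat M"
    and N: "N \<in> carrier_mat n n" "invertible_mat N"
  shows "invertible_mat (M * N)"
proof (rule invertible_mat_right_inverse[of _ n "minv N * minv M"])
  note M' = minv_inverse[OF M] and N' = minv_inverse[OF N]
  show "M * N \<in> carrier_mat n n" "minv N * minv M \<in> carrier_mat n n" using M N M' N' by auto
  have "M * N * (minv N * minv M) = M * (N * minv N) * minv M"
    using M(1) N(1) M'(1) N'(1) by (simp add: assoc_mult_mat_dim)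
  then show "M * N * (minv N * minv M) = 1\<^sub>m n" using M M' by (simp add: N')
qed

lemma invertible_diagm:
  assumes "\<And>i. i < n \<Longrightarrow> f i \<noteq> 0"
  shows "invertible_mat (diagm n f)"
proof (rule invertible_mat_right_inverse)
  have "diagm n (\<lambda>i. f i * (1 / f i)) = diagm n (\<lambda>_. 1)"
    by (rule diagm_cong) (use assms in simp)
  then show "diagm n f * diagm n (\<lambda>i. 1 / f i) = 1\<^sub>m n" by (simp add: diagm_mult_diagm)
qed simp_all

section \<open>Spectral theorem and inverse square roots\<close>

lemma orthonormal_cols_transpose_mult:
  "orthonormal_cols Q \<Longrightarrow> Q \<in> carrier_mat m n \<Longrightarrow> Q\<^sup>T * Q = 1\<^sub>m n"
  by (auto simp: orthonormal_cols_def)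

lemma orthonormal_cols_mult_transpose:
  "orthonormal_cols Q \<Longrightarrow> Q \<in> carrier_mat n n \<Longrightarrow> Q * Q\<^sup>T = 1\<^sub>m n"
  by (rule mat_mult_left_right_inverse[of "Q\<^sup>T" n Q]) (auto simp: orthonormal_cols_def)

lemma orthonormal_cols_transpose:
  "orthonormal_cols Q \<Longrightarrow> Q \<in> carrier_mat n n \<Longrightarrow> orthonormal_cols (Q\<^sup>T)"
  using orthonormal_cols_mult_transpose[of Q n] by (simp add: orthonormal_cols_def)

lemma orthonormal_cols_mult:
  assumes Q: "Q \<in> carrier_mat m n" "orthonormal_cols Q"
    and R: "R \<in> carrier_mat n k" "orthonormal_cols R"
  shows "orthonormal_cols (Q * R)"
proof -
  have "(Q * R)\<^sup>T * (Q * R) = R\<^sup>T * ((Q\<^sup>T * Q) * R)"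
    using Q(1) R(1) by (simp add: transpose_mult_dim assoc_mult_mat_dim)
  then show ?thesis
    using R by (simp add: orthonormal_cols_transpose_mult[OF Q(2,1)] orthonormal_cols_def)
qed

lemma orthonormal_cols_full_col_rank:
  assumes "orthonormal_cols Q"
  shows "full_col_rank Q"
  unfolding full_col_rank_def
proof (intro ballI impI)
  fix v assume v: "v \<in> carrier_vec (dim_col Q)" and "Q *\<^sub>v v = 0\<^sub>v (dim_row Q)"
  then have "Q\<^sup>T * Q *\<^sub>v v = 0\<^sub>v (dim_col Q)" by (simp add: assoc_mult_mat_vec_dim)
  then show "v = 0\<^sub>v (dim_col Q)" using assms v by (simp add: orthonormal_cols_def)
qed

lemma symmetric_eigenvalue_real:
  fixes M :: "real mat"
  assumes M: "M \<in> carrier_mat n n" and sym: "M\<^sup>T = M"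
    and ev: "eigenvalue (map_mat complex_of_real M) z"
  shows "z \<in> \<real>"
proof -
  let ?C = "map_mat complex_of_real M"
  have C: "?C \<in> carrier_mat n n" using M by simp
  obtain w where w: "w \<in> carrier_vec n" "w \<noteq> 0\<^sub>v n" "?C *\<^sub>v w = z \<cdot>\<^sub>v w"
    using ev C by (auto simp: eigenvalue_def eigenvector_def)
  have "?C *\<^sub>v conjugate w = conjugate (?C *\<^sub>v w)"
  proof (rule eq_vecI)
    fix i assume "i < dim_vec (conjugate (?C *\<^sub>v w))"
    then have i: "i < n" using M by simp
    have "conjugate (row ?C i) = row ?C i" using i M by (intro eq_vecI) auto
    then show "(?C *\<^sub>v conjugate w) $ i = conjugate (?C *\<^sub>v w) $ i"
      using i M w(1) conjugate_sprod_vec[of "row ?C i" n w] by simp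
  qed simp
  then have "?C *\<^sub>v conjugate w = cnj z \<cdot>\<^sub>v conjugate w"
    by (simp add: w(3) conjugate_smult_vec conjugate_complex_def)
  moreover have "w \<bullet> (?C *\<^sub>v conjugate w) = (?C *\<^sub>v w) \<bullet>c w"
    using scalar_prod_transpose_mult_mat_vec_dim[of ?C w "conjugate w"] C w(1) sym
    by (simp add: map_mat_transpose)
  ultimately have "cnj z * (w \<bullet>c w) = z * (w \<bullet>c w)" using w by simp
  then have "cnj z = z" using w by simp
  then show ?thesis by (simp add: Reals_cnj_iff)
qed

lemma symmetric_real_eigenvector:
  fixes M :: "real mat"
  assumes M: "M \<in> carrier_mat n n" and sym: "M\<^sup>T = M" and n: "0 < n"
  obtains v l where "v \<in> carrier_vec n" "v \<bullet> v = 1" "M *\<^sub>v v = l \<cdot>\<^sub>v v"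
proof -
  let ?C = "map_mat complex_of_real M"
  obtain z where z: "eigenvalue ?C z"
    using spectrum_non_empty[of ?C n] M n by (auto simp: spectrum_def)
  then obtain l where l: "z = complex_of_real l"
    using symmetric_eigenvalue_real[OF M sym z] by (auto elim: Reals_cases)
  have "poly (map_poly complex_of_real (char_poly M)) (complex_of_real l) = 0"
    using z M by (simp add: l eigenvalue_root_char_poly[of _ n] flip: of_real_hom.char_poly_hom)
  then have "eigenvalue M l"
    using M by (simp add: eigenvalue_root_char_poly)
  then obtain u where u: "u \<in> carrier_vec n" "u \<noteq> 0\<^sub>v n" "M *\<^sub>v u = l \<cdot>\<^sub>v u"
    using M by (auto simp: eigenvalue_def eigenvector_def)
  then have pos: "0 < u \<bullet> u" by (simp add: scalar_prod_self_pos_iff)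
  let ?v = "(1 / sqrt (u \<bullet> u)) \<cdot>\<^sub>v u"
  show thesis
  proof (rule that[of ?v l])
    show "?v \<in> carrier_vec n" using u by simp
    show "?v \<bullet> ?v = 1" using u pos by simp
    show "M *\<^sub>v ?v = l \<cdot>\<^sub>v ?v"
      using u M by (simp add: mult_mat_vec[of _ n n] smult_smult_assoc mult.commute)
  qed
qed

lemma unit_vec_extend_orthonormal_cols:
  fixes v :: "real vec"
  assumes v: "v \<in> carrier_vec n" and unit: "v \<bullet> v = 1"
  obtains Q where "Q \<in> carrier_mat n n" "orthonormal_cols Q" "col Q 0 = v"
proof -
  interpret cof_vec_space n "TYPE(real)" .
  have v0: "v \<noteq> 0\<^sub>v n" using v unit scalar_prod_self_pos_iff[OF v] by simp
  then have "n \<noteq> 0" using v by auto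
  define us where "us = gram_schmidt n (basis_completion v)"
  note basis = basis_completion[OF v v0]
  note us = gram_schmidt_result[OF basis(2,4,5) us_def]
  have len: "length us = n" using us(4) basis(6) by simp
  have carrier: "us ! i \<in> carrier_vec n" if "i < n" for i
    using us(3) that len by (meson nth_mem subsetD)
  obtain vs where "basis_completion v = v # vs"
    using basis(6,7) \<open>n \<noteq> 0\<close> by (cases "basis_completion v") auto
  then have "us ! 0 = v"
    using gram_schmidt_hd[OF v] len \<open>n \<noteq> 0\<close>
    by (simp add: us_def hd_conv_nth[symmetric] flip: length_0_conv)
  have orth: "us ! i \<bullet> us ! j = 0 \<longleftrightarrow> i \<noteq> j" if "i < n" "j < n" for i j
    using corthogonalD[OF us(2)] that len by simp
  have pos: "0 < us ! i \<bullet> us ! i" if "i < n" for i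
    using orth[OF that that] scalar_prod_self_ge_0[of "us ! i"] by linarith
  define Q where "Q = mat_of_cols n (map (\<lambda>u. (1 / sqrt (u \<bullet> u)) \<cdot>\<^sub>v u) us)"
  have Q: "Q \<in> carrier_mat n n" by (rule carrier_matI) (simp_all add: Q_def len)
  have col: "col Q i = (1 / sqrt (us ! i \<bullet> us ! i)) \<cdot>\<^sub>v us ! i" if "i < n" for i
    using that len carrier by (simp add: Q_def)
  show thesis
  proof (rule that[OF Q])
    show "col Q 0 = v" using col[of 0] \<open>n \<noteq> 0\<close> \<open>us ! 0 = v\<close> unit by simp
    have "(Q\<^sup>T * Q) $$ (i, j) = 1\<^sub>m n $$ (i, j)" if "i < n" "j < n" for i j
      using that Q orth[OF that] pos[of i] carrier[of i] carrier[of j] by (auto simp: col)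
    then show "orthonormal_cols Q"
      unfolding orthonormal_cols_def using Q by (intro eq_matI) auto
  qed
qed

definition scalar_block_sum :: "real \<Rightarrow> real mat \<Rightarrow> real mat" where
  "scalar_block_sum a M
    = four_block_mat (diagm 1 (\<lambda>_. a)) (0\<^sub>m 1 (dim_col M)) (0\<^sub>m (dim_row M) 1) M"

lemma scalar_block_sum_dim [simp]:
  "dim_row (scalar_block_sum a M) = Suc (dim_row M)"
  "dim_col (scalar_block_sum a M) = Suc (dim_col M)"
  by (simp_all add: scalar_block_sum_def)

lemma scalar_block_sum_index:
  "i < Suc (dim_row M) \<Longrightarrow> j < Suc (dim_col M) \<Longrightarrow> scalar_block_sum a M $$ (i, j)
    = (if i = 0 \<and> j = 0 then a else if i = 0 \<or> j = 0 then 0 else M $$ (i - 1, j - 1))"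
  by (auto simp: scalar_block_sum_def)

lemma scalar_block_sum_mult:
  "dim_col M = dim_row N
    \<Longrightarrow> scalar_block_sum a M * scalar_block_sum b N = scalar_block_sum (a * b) (M * N)"
  unfolding scalar_block_sum_def
  by (subst mult_four_block_mat[of _ 1 1 _ "dim_col M" _ "dim_row M" _ _ 1 _ "dim_col N"])
    (auto simp: diagm_mult_diagm intro!: cong_four_block_mat eq_matI)

lemma scalar_block_sum_transpose: "(scalar_block_sum a M)\<^sup>T = scalar_block_sum a (M\<^sup>T)"
  by (rule eq_matI) (auto simp: scalar_block_sum_index)

lemma scalar_block_sum_diagm: "scalar_block_sum a (diagm n f) = diagm (Suc n) (case_nat a f)"
  by (rule eq_matI) (auto simp: scalar_block_sum_index split: nat.split)

lemma orthonormal_cols_scalar_block_sum: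
  "orthonormal_cols Q \<Longrightarrow> orthonormal_cols (scalar_block_sum 1 Q)"
  by (auto simp: orthonormal_cols_def scalar_block_sum_transpose scalar_block_sum_mult
      scalar_block_sum_index intro!: eq_matI)

lemma symmetric_deflation:
  fixes M :: "real mat"
  assumes M: "M \<in> carrier_mat (Suc n) (Suc n)" and sym: "M\<^sup>T = M"
  obtains Q l M' where "Q \<in> carrier_mat (Suc n) (Suc n)" "orthonormal_cols Q"
    "M' \<in> carrier_mat n n" "M'\<^sup>T = M'" "M = Q * scalar_block_sum l M' * Q\<^sup>T"
proof -
  obtain v l where v: "v \<in> carrier_vec (Suc n)" "v \<bullet> v = 1" "M *\<^sub>v v = l \<cdot>\<^sub>v v"
    using symmetric_real_eigenvector[OF M sym] by auto
  obtain Q where Q: "Q \<in> carrier_mat (Suc n) (Suc n)" "orthonormal_cols Q" and col: "col Q 0 = v"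
    using unit_vec_extend_orthonormal_cols[OF v(1,2)] by blast
  define N where "N = Q\<^sup>T * M * Q"
  have N: "N \<in> carrier_mat (Suc n) (Suc n)" using M Q by (simp add: N_def)
  have Nsym: "N\<^sup>T = N" using M Q sym by (simp add: N_def transpose_mult_dim assoc_mult_mat_dim)
  have first_col: "N $$ (i, 0) = (if i = 0 then l else 0)" if "i < Suc n" for i
  proof -
    have "N $$ (i, 0) = col Q i \<bullet> (M *\<^sub>v v)"
      using that M Q(1) by (simp add: N_def assoc_mult_mat_dim mult_mat_vec_def flip: col)
    also have "\<dots> = l * (col Q i \<bullet> col Q 0)" using that v Q(1) by (simp add: col)
    also have "col Q i \<bullet> col Q 0 = (Q\<^sup>T * Q) $$ (i, 0)" using that Q(1) by simp
    finally show ?thesis using that by (simp add: orthonormal_cols_transpose_mult[OF Q(2,1)])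
  qed
  then have first_row: "N $$ (0, j) = (if j = 0 then l else 0)" if "j < Suc n" for j
    using that N Nsym by (metis carrier_matD index_transpose_mat(1) zero_less_Suc)
  define M' where "M' = mat n n (\<lambda>(i, j). N $$ (Suc i, Suc j))"
  have "N = scalar_block_sum l M'"
    using N by (intro eq_matI) (auto simp: scalar_block_sum_index M'_def first_col first_row)
  moreover have "M = Q * N * Q\<^sup>T"
  proof -
    have "Q * N * Q\<^sup>T = (Q * Q\<^sup>T) * M * (Q * Q\<^sup>T)"
      using M Q(1) by (simp add: N_def assoc_mult_mat_dim)
    then show ?thesis using M by (simp add: orthonormal_cols_mult_transpose[OF Q(2,1)])
  qed
  moreover have "M'\<^sup>T = M'"
    using N Nsym
    by (intro eq_matI) (auto simp: M'_def, metis Suc_less_eq carrier_matD index_transpose_mat(1))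
  ultimately show thesis using that[OF Q, of M' l] by (simp add: M'_def)
qed

theorem symmetric_diagonalization:
  fixes M :: "real mat"
  assumes "M \<in> carrier_mat n n" "M\<^sup>T = M"
  shows "\<exists>Q f. Q \<in> carrier_mat n n \<and> orthonormal_cols Q \<and> M = Q * diagm n f * Q\<^sup>T"
  using assms
proof (induction n arbitrary: M)
  case 0
  then show ?case by (intro exI[of _ "1\<^sub>m 0"] exI) (auto simp: orthonormal_cols_def intro!: eq_matI)
next
  case (Suc n)
  obtain Q l M' where Q: "Q \<in> carrier_mat (Suc n) (Suc n)" "orthonormal_cols Q"
    and M': "M' \<in> carrier_mat n n" "M'\<^sup>T = M'" and M: "M = Q * scalar_block_sum l M' * Q\<^sup>T"
    using symmetric_deflation[OF Suc.prems] .
  obtain Q' f where Q': "Q' \<in> carrier_mat n n" "orthonormal_cols Q'"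
    and "M' = Q' * diagm n f * Q'\<^sup>T"
    using Suc.IH[OF M'] by blast
  let ?Q = "Q * scalar_block_sum 1 Q'"
  have block: "scalar_block_sum 1 Q' \<in> carrier_mat (Suc n) (Suc n)"
    using Q' by (intro carrier_matI) auto
  have "scalar_block_sum l M'
      = scalar_block_sum 1 Q' * diagm (Suc n) (case_nat l f) * (scalar_block_sum 1 Q')\<^sup>T"
    using Q' \<open>M' = _\<close>
    by (simp add: scalar_block_sum_mult scalar_block_sum_transpose flip: scalar_block_sum_diagm)
  then have "M = ?Q * diagm (Suc n) (case_nat l f) * ?Q\<^sup>T"
    unfolding M using Q(1) Q'(1) by (simp add: transpose_mult_dim assoc_mult_mat_dim)
  moreover have "orthonormal_cols ?Q"
    by (rule orthonormal_cols_mult[OF Q block orthonormal_cols_scalar_block_sum[OF Q'(2)]])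
  moreover have "?Q \<in> carrier_mat (Suc n) (Suc n)" using Q(1) block by simp
  ultimately show ?case by blast
qed

lemma sym_pos_defD:
  assumes "sym_pos_def M" "M \<in> carrier_mat n n"
  shows "M\<^sup>T = M" and "v \<in> carrier_vec n \<Longrightarrow> v \<noteq> 0\<^sub>v n \<Longrightarrow> 0 < v \<bullet> (M *\<^sub>v v)"
  using assms by (auto simp: sym_pos_def_def)

lemma sym_pos_def_congruence:
  assumes M: "M \<in> carrier_mat n n" "sym_pos_def M" and C: "C \<in> carrier_mat n k" "full_col_rank C"
  shows "sym_pos_def (C\<^sup>T * M * C)"
proof -
  have "0 < v \<bullet> (C\<^sup>T * M * C *\<^sub>v v)" if v: "v \<in> carrier_vec k" "v \<noteq> 0\<^sub>v k" for v
  proof -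
    have "C *\<^sub>v v \<noteq> 0\<^sub>v n" using C v by (auto simp: full_col_rank_def)
    then have "0 < (C *\<^sub>v v) \<bullet> (M *\<^sub>v (C *\<^sub>v v))" using sym_pos_defD(2)[OF M(2,1)] C v by simp
    then show ?thesis
      using M(1) C(1) v by (simp add: assoc_mult_mat_vec_dim scalar_prod_transpose_mult_mat_vec_dim)
  qed
  moreover have "(C\<^sup>T * M * C)\<^sup>T = C\<^sup>T * M * C"
    using M(1) C(1) sym_pos_defD(1)[OF M(2,1)] by (simp add: transpose_mult_dim assoc_mult_mat_dim)
  ultimately show ?thesis using C by (auto simp: sym_pos_def_def)
qed

lemma sym_pos_def_diagm_iff: "sym_pos_def (diagm n f) \<longleftrightarrow> (\<forall>i<n. 0 < f i)"
proof (intro iffI allI impI)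
  fix i assume spd: "sym_pos_def (diagm n f)" and i: "i < n"
  have "unit_vec n i \<noteq> (0\<^sub>v n :: real vec)" using i by simp
  then have "0 < unit_vec n i \<bullet> (diagm n f *\<^sub>v unit_vec n i)"
    using sym_pos_defD(2)[OF spd diagm_carrier] by simp
  also have "\<dots> = f i"
    using i by (simp add: scalar_prod_left_unit[OF mult_mat_vec_carrier[OF diagm_carrier]]
        diagm_mult_vec_index del: index_mult_mat_vec)
  finally show "0 < f i" .
next
  assume pos: "\<forall>i<n. 0 < f i"
  have "0 < v \<bullet> (diagm n f *\<^sub>v v)" if v: "v \<in> carrier_vec n" "v \<noteq> 0\<^sub>v n" for v
  proof -
    obtain i where "i < n" "v $ i \<noteq> 0" using v by (auto simp: vec_eq_iff)
    then show ?thesis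
      unfolding scalar_prod_diagm[OF v(1)] using pos
      by (intro sum_pos2[of _ i]) (auto simp: less_imp_le)
  qed
  then show "sym_pos_def (diagm n f)" by (simp add: sym_pos_def_def)
qed

lemma sym_pos_def_inverse_sqrt:
  assumes M: "M \<in> carrier_mat n n" and spd: "sym_pos_def M"
  obtains N where "N \<in> carrier_mat n n" "sym_pos_def N" "N * N * M = 1\<^sub>m n"
proof -
  obtain Q f where Q: "Q \<in> carrier_mat n n" "orthonormal_cols Q" and Meq: "M = Q * diagm n f * Q\<^sup>T"
    using symmetric_diagonalization[OF M sym_pos_defD(1)[OF spd M]] by blast
  note QTQ = orthonormal_cols_transpose_mult[OF Q(2,1)]
  have QTQ_mult: "Q\<^sup>T * (Q * Y) = Y" if "dim_row Y = n" for Y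
    using that Q by (simp add: QTQ flip: assoc_mult_mat_dim)
  have "Q\<^sup>T * M * Q = diagm n f"
    using Q(1) unfolding Meq by (simp add: assoc_mult_mat_dim QTQ_mult QTQ)
  then have f: "0 < f i" if "i < n" for i
    using sym_pos_def_congruence[OF M spd Q(1) orthonormal_cols_full_col_rank[OF Q(2)]] that
    by (simp add: sym_pos_def_diagm_iff)
  define g where "g i = 1 / sqrt (f i)" for i
  define N where "N = Q * diagm n g * Q\<^sup>T"
  show thesis
  proof (rule that)
    show "N \<in> carrier_mat n n" using Q by (auto simp: N_def)
    have "sym_pos_def (diagm n g)" using f by (simp add: sym_pos_def_diagm_iff g_def)
    then show "sym_pos_def N"
      using sym_pos_def_congruence[of "diagm n g" n "Q\<^sup>T" n] Q
      by (simp add: N_def orthonormal_cols_full_col_rank orthonormal_cols_transpose)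
    have "N * N * M = Q * (diagm n g * diagm n g * diagm n f) * Q\<^sup>T"
      unfolding N_def Meq using Q(1) by (simp add: assoc_mult_mat_dim QTQ_mult)
    also have "diagm n g * diagm n g * diagm n f = diagm n (\<lambda>_. 1)"
      unfolding diagm_mult_diagm by (rule diagm_cong) (use f in \<open>force simp: g_def\<close>)
    finally show "N * N * M = 1\<^sub>m n" using Q by (simp add: orthonormal_cols_mult_transpose)
  qed
qed

lemma polar_factor:
  assumes M: "M \<in> carrier_mat n n" "sym_pos_def M"
    and T: "T \<in> carrier_mat n n" "T\<^sup>T * M * T = 1\<^sub>m n"
  obtains N W where "N \<in> carrier_mat n n" "sym_pos_def N" "N * N * M = 1\<^sub>m n"
    "W \<in> carrier_mat n n" "orthonormal_cols W" "T = N * W"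
proof -
  obtain N where N: "N \<in> carrier_mat n n" "sym_pos_def N" "N * N * M = 1\<^sub>m n"
    using sym_pos_def_inverse_sqrt[OF M] .
  have sym: "N\<^sup>T = N" "M\<^sup>T = M" using sym_pos_defD(1) M N by blast+
  have NNM: "N * (N * M) = 1\<^sub>m n" using N M by (simp add: assoc_mult_mat_dim)
  define W where "W = N * M * T"
  have "W\<^sup>T * W = T\<^sup>T * M * (N * (N * M)) * T"
    unfolding W_def using M(1) N(1) T(1) by (simp add: transpose_mult_dim assoc_mult_mat_dim sym)
  also have "\<dots> = 1\<^sub>m n" using M(1) T by (simp add: NNM)
  finally have "orthonormal_cols W" using T by (simp add: orthonormal_cols_def W_def)
  moreover have "N * W = N * (N * M) * T"
    unfolding W_def using M(1) N(1) T(1) by (simp add: assoc_mult_mat_dim)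
  then have "T = N * W" using T by (simp add: NNM)
  moreover have "W \<in> carrier_mat n n" using N(1) M(1) T(1) by (simp add: W_def)
  ultimately show thesis using that N by blast
qed

section \<open>Operator norm\<close>

lemma vnorm_ge_0 [simp]: "0 \<le> vnorm v"
  by (simp add: vnorm_def)

lemma vnorm_power2: "(vnorm v)\<^sup>2 = v \<bullet> v"
  by (simp add: vnorm_def)

lemma vnorm_zero [simp]: "vnorm (0\<^sub>v n) = 0"
  by (simp add: vnorm_def)

lemma vnorm_smult: "vnorm (a \<cdot>\<^sub>v v) = \<bar>a\<bar> * vnorm v"
  by (simp add: vnorm_def real_sqrt_mult flip: mult.assoc)

lemma vnorm_le_iff: "0 \<le> b \<Longrightarrow> vnorm u \<le> b * vnorm v \<longleftrightarrow> u \<bullet> u \<le> b\<^sup>2 * (v \<bullet> v)"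
  using abs_le_square_iff[of "vnorm u" "b * vnorm v"] by (simp add: power_mult_distrib vnorm_power2)

lemma mult_mat_vec_bounded:
  fixes M :: "real mat"
  obtains C where "0 \<le> C" "\<And>v. v \<in> carrier_vec (dim_col M) \<Longrightarrow> vnorm (M *\<^sub>v v) \<le> C * vnorm v"
proof
  define K where "K = (\<Sum>i<dim_row M. row M i \<bullet> row M i)"
  have K: "0 \<le> K" unfolding K_def by (intro sum_nonneg scalar_prod_self_ge_0)
  then show "0 \<le> sqrt K" by simp
  fix v :: "real vec" assume v: "v \<in> carrier_vec (dim_col M)"
  have "(row M i \<bullet> v)\<^sup>2 \<le> (row M i \<bullet> row M i) * (v \<bullet> v)" for i
    using Cauchy_Schwarz_ineq_sum[of "\<lambda>j. row M i $ j" "\<lambda>j. v $ j" "{0..<dim_col M}"] v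
    by (simp add: scalar_prod_def power2_eq_square)
  then have "(M *\<^sub>v v) \<bullet> (M *\<^sub>v v) \<le> K * (v \<bullet> v)"
    by (simp add: scalar_prod_self[of "M *\<^sub>v v"] K_def sum_distrib_right sum_mono)
  then show "vnorm (M *\<^sub>v v) \<le> sqrt K * vnorm v"
    using K by (subst vnorm_le_iff) simp_all
qed

lemma vnorm_le_mnorm_unit_ball:
  assumes "v \<in> carrier_vec (dim_col M)" "vnorm v \<le> 1"
  shows "vnorm (M *\<^sub>v v) \<le> mnorm M"
proof -
  obtain C where C: "0 \<le> C" "\<And>v. v \<in> carrier_vec (dim_col M) \<Longrightarrow> vnorm (M *\<^sub>v v) \<le> C * vnorm v"
    using mult_mat_vec_bounded[of M] by blast
  have "vnorm (M *\<^sub>v u) \<le> C" if "u \<in> carrier_vec (dim_col M)" "vnorm u \<le> 1" for u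
    using C(2)[OF that(1)] mult_left_mono[OF that(2) C(1)] by simp
  then have "bdd_above {vnorm (M *\<^sub>v v) | v. v \<in> carrier_vec (dim_col M) \<and> vnorm v \<le> 1}"
    by (intro bdd_aboveI[of _ C]) auto
  then show ?thesis
    unfolding mnorm_def using assms by (intro cSup_upper) auto
qed

lemma mnorm_ge_0 [simp]: "0 \<le> mnorm M"
  using vnorm_le_mnorm_unit_ball[of "0\<^sub>v (dim_col M)" M] by simp

lemma vnorm_mult_mat_vec_le:
  assumes v: "v \<in> carrier_vec (dim_col M)"
  shows "vnorm (M *\<^sub>v v) \<le> mnorm M * vnorm v"
proof (cases "v = 0\<^sub>v (dim_col M)")
  case False
  then have pos: "0 < vnorm v"
    using scalar_prod_self_pos_iff[OF v] by (simp add: vnorm_def)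
  let ?u = "(1 / vnorm v) \<cdot>\<^sub>v v"
  have "vnorm (M *\<^sub>v ?u) \<le> mnorm M"
    using v pos by (intro vnorm_le_mnorm_unit_ball) (simp_all add: vnorm_smult)
  moreover have "M *\<^sub>v ?u = (1 / vnorm v) \<cdot>\<^sub>v (M *\<^sub>v v)"
    using v by (intro mult_mat_vec[of _ "dim_row M" "dim_col M"]) auto
  ultimately show ?thesis using pos by (simp add: vnorm_smult field_simps)
qed simp

lemma mnorm_le:
  assumes "0 \<le> b" "\<And>v. v \<in> carrier_vec (dim_col M) \<Longrightarrow> vnorm (M *\<^sub>v v) \<le> b * vnorm v"
  shows "mnorm M \<le> b"
  unfolding mnorm_def
proof (rule cSup_least)
  show "{vnorm (M *\<^sub>v v) | v. v \<in> carrier_vec (dim_col M) \<and> vnorm v \<le> 1} \<noteq> {}"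
    by (auto intro!: exI[of _ "0\<^sub>v (dim_col M)"])
next
  fix x assume "x \<in> {vnorm (M *\<^sub>v v) | v. v \<in> carrier_vec (dim_col M) \<and> vnorm v \<le> 1}"
  then obtain v where "x = vnorm (M *\<^sub>v v)" "v \<in> carrier_vec (dim_col M)" "vnorm v \<le> 1" by blast
  then show "x \<le> b" using assms(2)[of v] mult_left_mono[of "vnorm v" 1 b] assms(1) by simp
qed

lemma mnorm_le_iff:
  assumes b: "0 \<le> b" and M: "M \<in> carrier_mat m n"
  shows "mnorm M \<le> b \<longleftrightarrow> (\<forall>v\<in>carrier_vec n. (M *\<^sub>v v) \<bullet> (M *\<^sub>v v) \<le> b\<^sup>2 * (v \<bullet> v))"
  unfolding vnorm_le_iff[OF b, symmetric]
proof
  assume le: "mnorm M \<le> b"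
  show "\<forall>v\<in>carrier_vec n. vnorm (M *\<^sub>v v) \<le> b * vnorm v"
  proof
    fix v :: "real vec" assume "v \<in> carrier_vec n"
    then have "vnorm (M *\<^sub>v v) \<le> mnorm M * vnorm v"
      using M by (intro vnorm_mult_mat_vec_le) simp
    also have "\<dots> \<le> b * vnorm v" using le by (rule mult_right_mono) simp
    finally show "vnorm (M *\<^sub>v v) \<le> b * vnorm v" .
  qed
qed (use b M in \<open>auto intro: mnorm_le\<close>)

lemma mnorm_mult_le:
  assumes "dim_col A = dim_row B"
  shows "mnorm (A * B) \<le> mnorm A * mnorm B"
proof (rule mnorm_le)
  fix v :: "real vec" assume v: "v \<in> carrier_vec (dim_col (A * B))"
  have "vnorm (A * B *\<^sub>v v) = vnorm (A *\<^sub>v (B *\<^sub>v v))"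
    using v assms by (simp add: assoc_mult_mat_vec_dim)
  also have "\<dots> \<le> mnorm A * vnorm (B *\<^sub>v v)"
    using assms by (intro vnorm_mult_mat_vec_le) (auto intro: carrier_vecI)
  also have "\<dots> \<le> mnorm A * (mnorm B * vnorm v)"
    using v by (intro mult_left_mono vnorm_mult_mat_vec_le) simp_all
  finally show "vnorm (A * B *\<^sub>v v) \<le> mnorm A * mnorm B * vnorm v" by (simp add: mult.assoc)
qed simp

lemma mnorm_diagm_le:
  assumes "0 \<le> b" "\<And>i. i < n \<Longrightarrow> \<bar>f i\<bar> \<le> b"
  shows "mnorm (diagm n f) \<le> b"
  unfolding mnorm_le_iff[OF \<open>0 \<le> b\<close> diagm_carrier]
proof
  fix v :: "real vec" assume v: "v \<in> carrier_vec n"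
  have "(diagm n f *\<^sub>v v) \<bullet> (diagm n f *\<^sub>v v) = (\<Sum>i<n. (f i)\<^sup>2 * (v $ i)\<^sup>2)"
    using v
    by (simp add: scalar_prod_self diagm_mult_vec_index power_mult_distrib del: index_mult_mat_vec)
  also have "\<dots> \<le> (\<Sum>i<n. b\<^sup>2 * (v $ i)\<^sup>2)"
    using assms abs_le_square_iff[of "f _" b] by (intro sum_mono mult_right_mono) auto
  also have "\<dots> = b\<^sup>2 * (v \<bullet> v)"
    using v by (simp add: scalar_prod_self sum_distrib_left)
  finally show "(diagm n f *\<^sub>v v) \<bullet> (diagm n f *\<^sub>v v) \<le> b\<^sup>2 * (v \<bullet> v)" .
qed

section \<open>Quadratic forms and graphs of matrices\<close>



lemma scalar_prod_add_mult_mat_vec_dim: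
  fixes M N :: "'a :: comm_semiring_0 mat"
  assumes "dim_row M = dim_vec u" "dim_row N = dim_vec u"
    and "dim_col M = dim_vec v" "dim_col N = dim_vec v"
  shows "u \<bullet> ((M + N) *\<^sub>v v) = u \<bullet> (M *\<^sub>v v) + u \<bullet> (N *\<^sub>v v)"
proof -
  have "M \<in> carrier_mat (dim_vec u) (dim_vec v)" "N \<in> carrier_mat (dim_vec u) (dim_vec v)"
    using assms by (auto intro: carrier_matI)
  then show ?thesis
    by (simp add: add_mult_distrib_mat_vec[of _ "dim_vec u" "dim_vec v"]
        scalar_prod_add_distrib[of _ "dim_vec u"] carrier_vec_dim_vec)
qed

lemma scalar_prod_diagm_le:
  assumes v: "v \<in> carrier_vec n" and "\<And>i. i < n \<Longrightarrow> v $ i \<noteq> 0 \<Longrightarrow> f i \<le> b"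
  shows "v \<bullet> (diagm n f *\<^sub>v v) \<le> b * (v \<bullet> v)"
proof -
  have "f i * (v $ i)\<^sup>2 \<le> b * (v $ i)\<^sup>2" if "i < n" for i
    using assms(2)[OF that] by (cases "v $ i = 0") (simp_all add: mult_right_mono)
  then show ?thesis
    unfolding scalar_prod_diagm[OF v] using v
    by (auto simp: scalar_prod_self sum_distrib_left intro!: sum_mono)
qed

lemma le_scalar_prod_diagm:
  assumes v: "v \<in> carrier_vec n" and "\<And>i. i < n \<Longrightarrow> v $ i \<noteq> 0 \<Longrightarrow> b \<le> f i"
  shows "b * (v \<bullet> v) \<le> v \<bullet> (diagm n f *\<^sub>v v)"
  using scalar_prod_diagm_le[of v n "\<lambda>i. - f i" "- b"] assms
  by (simp add: scalar_prod_diagm sum_negf)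

lemma orthonormal_blocks_norm:
  fixes T F :: "real mat"
  assumes T: "T \<in> carrier_mat m p" and F: "F \<in> carrier_mat q p"
    and orth: "T\<^sup>T * T + F\<^sup>T * F = 1\<^sub>m p" and v: "v \<in> carrier_vec p"
  shows "v \<bullet> v = (T *\<^sub>v v) \<bullet> (T *\<^sub>v v) + (F *\<^sub>v v) \<bullet> (F *\<^sub>v v)"
  using scalar_prod_add_mult_mat_vec_dim[of "T\<^sup>T * T" v "F\<^sup>T * F" v] T F v
  by (simp add: orth scalar_prod_transpose_mult_mat_vec_dim)

lemma graph_gram:
  fixes E T :: "real mat"
  assumes "E \<in> carrier_mat q p" "T \<in> carrier_mat p p"
  shows "T\<^sup>T * (1\<^sub>m p + E\<^sup>T * E) * T = T\<^sup>T * T + (E * T)\<^sup>T * (E * T)"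
  using assms
  by (simp add: mult_add_distrib_mat_dim add_mult_distrib_mat_dim transpose_mult_dim
      assoc_mult_mat_dim)

lemma graph_gram_sym_pos_def:
  assumes E: "E \<in> carrier_mat q p"
  shows "sym_pos_def (1\<^sub>m p + E\<^sup>T * E)"
proof -
  have "0 < v \<bullet> ((1\<^sub>m p + E\<^sup>T * E) *\<^sub>v v)" if v: "v \<in> carrier_vec p" "v \<noteq> 0\<^sub>v p" for v
    using E v scalar_prod_self_pos_iff[OF v(1)]
    by (simp add: scalar_prod_add_mult_mat_vec_dim scalar_prod_transpose_mult_mat_vec_dim
        add_pos_nonneg)
  moreover have "(1\<^sub>m p + E\<^sup>T * E)\<^sup>T = 1\<^sub>m p + E\<^sup>T * E"
    using E by (simp add: transpose_add[of _ p p] transpose_mult_dim)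
  ultimately show ?thesis using E by (auto simp: sym_pos_def_def)
qed

text \<open>With \<open>w = T v\<close> one has \<open>|v|\<^sup>2 = |w|\<^sup>2 + |E w|\<^sup>2\<close>, so \<open>|E T v|\<^sup>2 / |v|\<^sup>2\<close> is the image of
  \<open>|E w|\<^sup>2 / |w|\<^sup>2\<close> under the increasing map \<open>t / (1 + t)\<close>.\<close>
lemma mnorm_orthonormal_graph_le:
  assumes E: "E \<in> carrier_mat q p" and T: "T \<in> carrier_mat p p"
    and orth: "T\<^sup>T * T + (E * T)\<^sup>T * (E * T) = 1\<^sub>m p"
  shows "mnorm (E * T) \<le> mnorm E / sqrt (1 + (mnorm E)\<^sup>2)"
proof -
  let ?e = "mnorm E"
  have pos: "0 < 1 + ?e\<^sup>2" by (simp add: add_pos_nonneg)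
  have ET: "E * T \<in> carrier_mat q p" using E T by simp
  have "(E * T *\<^sub>v v) \<bullet> (E * T *\<^sub>v v) \<le> (?e / sqrt (1 + ?e\<^sup>2))\<^sup>2 * (v \<bullet> v)"
    if v: "v \<in> carrier_vec p" for v
  proof -
    define w where "w = T *\<^sub>v v"
    have ETv: "E * T *\<^sub>v v = E *\<^sub>v w" using E T v by (simp add: w_def)
    have "(E *\<^sub>v w) \<bullet> (E *\<^sub>v w) \<le> ?e\<^sup>2 * (w \<bullet> w)"
      using mnorm_le_iff[OF mnorm_ge_0 E, of E] T v by (simp add: w_def)
    also have "w \<bullet> w = v \<bullet> v - (E *\<^sub>v w) \<bullet> (E *\<^sub>v w)"
      using orthonormal_blocks_norm[OF T ET orth v] unfolding ETv by (simp add: w_def)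
    finally show ?thesis unfolding ETv using pos by (simp add: power_divide field_simps)
  qed
  then show ?thesis using mnorm_le_iff[OF _ ET] by simp
qed

lemma mnorm_le_orthonormal_graph:
  assumes E: "E \<in> carrier_mat q p" and T: "T \<in> carrier_mat p p"
    and orth: "T\<^sup>T * T + (E * T)\<^sup>T * (E * T) = 1\<^sub>m p" and less: "mnorm (E * T) < 1"
  shows "mnorm E \<le> mnorm (E * T) / sqrt (1 - (mnorm (E * T))\<^sup>2)"
proof -
  let ?f = "mnorm (E * T)" and ?T' = "T\<^sup>T * (1\<^sub>m p + E\<^sup>T * E)"
  have pos: "0 < 1 - ?f\<^sup>2" using less by (simp add: power_less_one_iff)
  have ET: "E * T \<in> carrier_mat q p" using E T by simp
  have T': "?T' \<in> carrier_mat p p" "T * ?T' = 1\<^sub>m p"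
    using mat_mult_left_right_inverse[of ?T' p T] E T by (simp_all add: graph_gram orth)
  have "(E *\<^sub>v w) \<bullet> (E *\<^sub>v w) \<le> (?f / sqrt (1 - ?f\<^sup>2))\<^sup>2 * (w \<bullet> w)" if w: "w \<in> carrier_vec p" for w
  proof -
    define v where "v = ?T' *\<^sub>v w"
    have v: "v \<in> carrier_vec p" unfolding v_def by (rule mult_mat_vec_carrier[OF T'(1) w])
    have Tv: "T *\<^sub>v v = w"
      unfolding v_def using assoc_mult_mat_vec[OF T T'(1) w] w by (simp add: T'(2))
    have ETv: "E * T *\<^sub>v v = E *\<^sub>v w" using E T v by (simp add: Tv)
    have "(E *\<^sub>v w) \<bullet> (E *\<^sub>v w) \<le> ?f\<^sup>2 * (v \<bullet> v)"
      using mnorm_le_iff[OF mnorm_ge_0 ET, of "E * T"] v by (simp flip: ETv)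
    also have "v \<bullet> v = w \<bullet> w + (E *\<^sub>v w) \<bullet> (E *\<^sub>v w)"
      using orthonormal_blocks_norm[OF T ET orth v] by (simp add: Tv ETv)
    finally show ?thesis using pos by (simp add: power_divide field_simps)
  qed
  then show ?thesis using mnorm_le_iff[OF _ E] pos by simp
qed

lemma mnorm_orthonormal_graph:
  assumes E: "E \<in> carrier_mat q p" and T: "T \<in> carrier_mat p p"
    and orth: "T\<^sup>T * T + (E * T)\<^sup>T * (E * T) = 1\<^sub>m p"
  shows "mnorm (E * T) = mnorm E / sqrt (1 + (mnorm E)\<^sup>2)"
proof (rule antisym)
  let ?e = "mnorm E" and ?f = "mnorm (E * T)"
  show upper: "?f \<le> ?e / sqrt (1 + ?e\<^sup>2)" by (rule mnorm_orthonormal_graph_le[OF assms])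
  have pos: "0 < 1 + ?e\<^sup>2" by (simp add: add_pos_nonneg)
  have "?e < sqrt (1 + ?e\<^sup>2)" by (simp add: real_less_rsqrt)
  then have "?e / sqrt (1 + ?e\<^sup>2) < 1" using pos by simp
  then have less: "?f < 1" using upper by simp
  then have pos': "0 < 1 - ?f\<^sup>2" by (simp add: power_less_one_iff)
  have "?e\<^sup>2 \<le> (?f / sqrt (1 - ?f\<^sup>2))\<^sup>2"
    by (rule power_mono[OF mnorm_le_orthonormal_graph[OF assms less]]) simp
  also have "\<dots> = ?f\<^sup>2 / (1 - ?f\<^sup>2)" using pos' by (simp add: power_divide)
  finally have "?e\<^sup>2 \<le> ?f\<^sup>2 * (1 + ?e\<^sup>2)" using pos' by (simp add: field_simps)
  then have "(?e / sqrt (1 + ?e\<^sup>2))\<^sup>2 \<le> ?f\<^sup>2" using pos by (simp add: power_divide field_simps)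
  then show "?e / sqrt (1 + ?e\<^sup>2) \<le> ?f" by (rule power2_le_imp_le) simp
qed

section \<open>Perturbation of Ritz values\<close>

text \<open>The conditions on \<open>v\<close> are the rows of a square matrix whose row \<open>i0\<close> vanishes.\<close>
lemma exists_vec_vanishing_coordinates:
  fixes T :: "real mat"
  assumes T: "T \<in> carrier_mat p p" and \<pi>: "\<And>j. j < p \<Longrightarrow> \<pi> j < p" and i0: "i0 < p"
  obtains v where "v \<in> carrier_vec p" "v \<noteq> 0\<^sub>v p"
    "\<And>j. j < p \<Longrightarrow> j \<noteq> i0 \<Longrightarrow> S j \<Longrightarrow> (T *\<^sub>v v) $ j = 0"
    "\<And>j. j < p \<Longrightarrow> j \<noteq> i0 \<Longrightarrow> \<not> S j \<Longrightarrow> v $ \<pi> j = 0"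
proof -
  define K where "K = mat_of_rows p
    (map (\<lambda>j. if j = i0 then 0\<^sub>v p else if S j then row T j else unit_vec p (\<pi> j)) [0..<p])"
  have K: "K \<in> carrier_mat p p" by (rule carrier_matI) (simp_all add: K_def)
  have row: "row K j = (if j = i0 then 0\<^sub>v p else if S j then row T j else unit_vec p (\<pi> j))"
    if "j < p" for j
    using that T by (simp add: K_def)
  have "K $$ (i0, l) = 0" if "l < p" for l
    using arg_cong[OF row[OF i0], of "\<lambda>u. u $ l"] that K i0 by simp
  then have "det K = 0"
    using laplace_expansion_row[OF K i0] by simp
  then obtain v where v: "v \<in> carrier_vec p" "v \<noteq> 0\<^sub>v p" "K *\<^sub>v v = 0\<^sub>v p"
    using det_0_iff_vec_prod_zero[OF K] by blast
  have orthogonal: "row K j \<bullet> v = 0" if "j < p" for j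
    using that K arg_cong[OF v(3), of "\<lambda>u. u $ j"] by simp
  show thesis
  proof (rule that[OF v(1,2)])
    show "(T *\<^sub>v v) $ j = 0" if "j < p" "j \<noteq> i0" "S j" for j
      using orthogonal[of j] that T by (simp add: row)
    show "v $ \<pi> j = 0" if "j < p" "j \<noteq> i0" "\<not> S j" for j
      using orthogonal[of j] that v(1) \<pi> by (simp add: row)
  qed
qed

text \<open>A Courant--Fischer argument: on a suitable \<open>v\<close> the Rayleigh quotient of \<open>diagm p ah\<close> is at
  least \<open>ah (\<pi> i0)\<close> while that of \<open>diagm p a\<close> at \<open>T v\<close> is at most \<open>a i0\<close>, and the two forms
  differ by at most \<open>|F v|\<^sup>2\<close>.\<close>
lemma ritz_value_upper_bound:
  fixes a b ah :: "nat \<Rightarrow> real"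
  assumes T: "T \<in> carrier_mat p p" and F: "F \<in> carrier_mat q p"
    and orth: "T\<^sup>T * T + F\<^sup>T * F = 1\<^sub>m p"
    and ritz: "T\<^sup>T * diagm p a * T + F\<^sup>T * diagm q b * F = diagm p ah"
    and \<pi>: "bij_betw \<pi> {..<p} {..<p}" and i0: "i0 < p" and a0: "0 \<le> a i0"
    and b: "\<And>i. i < q \<Longrightarrow> b i \<le> 1"
    and mono: "\<And>j. j < p \<Longrightarrow> a i0 < a j \<Longrightarrow> ah (\<pi> i0) \<le> ah (\<pi> j)"
  shows "ah (\<pi> i0) \<le> a i0 + (mnorm F)\<^sup>2"
proof -
  have \<pi>_less: "\<pi> j < p" if "j < p" for j
    using \<pi> that by (auto simp: bij_betw_def)
  obtain v where v: "v \<in> carrier_vec p" "v \<noteq> 0\<^sub>v p"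
    and Tv_zero: "\<And>j. j < p \<Longrightarrow> j \<noteq> i0 \<Longrightarrow> a i0 < a j \<Longrightarrow> (T *\<^sub>v v) $ j = 0"
    and v_zero: "\<And>j. j < p \<Longrightarrow> j \<noteq> i0 \<Longrightarrow> \<not> a i0 < a j \<Longrightarrow> v $ \<pi> j = 0"
    using exists_vec_vanishing_coordinates[OF T, of \<pi> i0 "\<lambda>j. a i0 < a j"] \<pi>_less i0 by blast
  define w where "w = T *\<^sub>v v"
  define z where "z = F *\<^sub>v v"
  have w: "w \<in> carrier_vec p" and z: "z \<in> carrier_vec q" using T F v by (simp_all add: w_def z_def)
  have z_le: "z \<bullet> z \<le> (mnorm F)\<^sup>2 * (v \<bullet> v)"
    using mnorm_le_iff[OF mnorm_ge_0 F, of F] v(1) by (simp add: z_def)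
  have norm: "v \<bullet> v = w \<bullet> w + z \<bullet> z"
    unfolding w_def z_def by (rule orthonormal_blocks_norm[OF T F orth v(1)])
  have "ah (\<pi> i0) * (v \<bullet> v) \<le> v \<bullet> (diagm p ah *\<^sub>v v)"
  proof (rule le_scalar_prod_diagm[OF v(1)])
    fix l assume l: "l < p" "v $ l \<noteq> 0"
    then obtain j where j: "j < p" "l = \<pi> j" using \<pi> by (auto simp: bij_betw_def)
    then show "ah (\<pi> i0) \<le> ah l"
      using v_zero[of j] mono[of j] l by (cases "j = i0") auto
  qed
  also have "\<dots> = w \<bullet> (diagm p a *\<^sub>v w) + z \<bullet> (diagm q b *\<^sub>v z)"
    using T F v(1)
    by (simp add: w_def z_def assoc_mult_mat_vec_dim scalar_prod_transpose_mult_mat_vec_dim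
        scalar_prod_add_mult_mat_vec_dim flip: ritz)
  also have "\<dots> \<le> a i0 * (w \<bullet> w) + 1 * (z \<bullet> z)"
  proof (intro add_mono scalar_prod_diagm_le)
    show "a j \<le> a i0" if "j < p" "w $ j \<noteq> 0" for j
      using that Tv_zero[of j] unfolding w_def by (cases "j = i0"; cases "a i0 < a j") auto
  qed (use w z b in auto)
  also have "\<dots> \<le> a i0 * (v \<bullet> v) + (mnorm F)\<^sup>2 * (v \<bullet> v)"
    using z_le a0 by (intro add_mono mult_left_mono) (simp_all add: norm)
  finally have "ah (\<pi> i0) * (v \<bullet> v) \<le> (a i0 + (mnorm F)\<^sup>2) * (v \<bullet> v)"
    by (simp add: distrib_right)
  then show ?thesis using v scalar_prod_self_pos_iff[OF v(1)] by simp
qed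

lemma congruence_diagm_complement:
  assumes "T \<in> carrier_mat m n"
  shows "T\<^sup>T * diagm m (\<lambda>i. 1 - f i) * T = T\<^sup>T * T - T\<^sup>T * diagm m f * T"
proof -
  have "diagm m (\<lambda>i. 1 - f i) = 1\<^sub>m m - diagm m f"
    using diagm_minus[of m "\<lambda>_. 1" f] by simp
  then show ?thesis
    using assms
    by (simp add: mult_minus_distrib_mat[of _ n m _ m] minus_mult_distrib_mat[of _ n m _ _ n])
qed

lemma ritz_value_perturbation:
  fixes a b ah :: "nat \<Rightarrow> real"
  assumes T: "T \<in> carrier_mat p p" and F: "F \<in> carrier_mat q p"
    and orth: "T\<^sup>T * T + F\<^sup>T * F = 1\<^sub>m p"
    and ritz: "T\<^sup>T * diagm p a * T + F\<^sup>T * diagm q b * F = diagm p ah"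
    and a: "\<And>i. i < p \<Longrightarrow> 0 \<le> a i \<and> a i \<le> 1" and b: "\<And>i. i < q \<Longrightarrow> 0 \<le> b i \<and> b i \<le> 1"
    and \<pi>: "bij_betw \<pi> {..<p} {..<p}"
    and mono: "\<And>i j. i < p \<Longrightarrow> j < p \<Longrightarrow> a i < a j \<Longrightarrow> ah (\<pi> i) \<le> ah (\<pi> j)"
    and i0: "i0 < p"
  shows "\<bar>ah (\<pi> i0) - a i0\<bar> \<le> (mnorm F)\<^sup>2"
proof -
  have "ah (\<pi> i0) \<le> a i0 + (mnorm F)\<^sup>2"
    by (rule ritz_value_upper_bound[OF T F orth ritz \<pi> i0]) (use a b i0 mono in auto)
  moreover have "1 - ah (\<pi> i0) \<le> 1 - a i0 + (mnorm F)\<^sup>2"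
  proof (rule ritz_value_upper_bound[OF T F orth _ \<pi> i0])
    have "T\<^sup>T * diagm p (\<lambda>i. 1 - a i) * T + F\<^sup>T * diagm q (\<lambda>i. 1 - b i) * F
      = (T\<^sup>T * T + F\<^sup>T * F) - (T\<^sup>T * diagm p a * T + F\<^sup>T * diagm q b * F)"
      unfolding congruence_diagm_complement[OF T] congruence_diagm_complement[OF F]
      using T F by (intro eq_matI) auto
    also have "\<dots> = diagm p (\<lambda>i. 1 - ah i)"
      unfolding orth ritz using diagm_minus[of p "\<lambda>_. 1" ah] by simp
    finally show "T\<^sup>T * diagm p (\<lambda>i. 1 - a i) * T + F\<^sup>T * diagm q (\<lambda>i. 1 - b i) * F
      = diagm p (\<lambda>i. 1 - ah i)" .
  qed (use a b i0 mono in auto)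
  ultimately show ?thesis by linarith
qed

section \<open>Chordal distance of squared generalized singular values\<close>

lemma sqrt_one_plus_power4_div:
  fixes c s :: real
  assumes "s \<noteq> 0"
  shows "sqrt (1 + (c / s) ^ 4) = sqrt (c ^ 4 + s ^ 4) / s\<^sup>2"
proof -
  have "1 + (c / s) ^ 4 = (c ^ 4 + s ^ 4) / (s\<^sup>2)\<^sup>2"
    using assms by (simp add: power_divide field_simps)
  then show ?thesis by (simp only: real_sqrt_divide real_sqrt_abs abs_power2)
qed

lemma chordal_e_sqratio:
  assumes nz: "c \<noteq> 0 \<or> s \<noteq> 0" and nz': "c' \<noteq> 0 \<or> s' \<noteq> 0"
  shows "chordal_e (sqratio c s) (sqratio c' s')
    = \<bar>c\<^sup>2 * s'\<^sup>2 - c'\<^sup>2 * s\<^sup>2\<bar> / (sqrt (c ^ 4 + s ^ 4) * sqrt (c' ^ 4 + s' ^ 4))"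
proof (cases "s = 0"; cases "s' = 0")
  assume "s = 0" "s' = 0"
  then show ?thesis by (simp add: sqratio_def chordal_e_def)
next
  assume "s = 0" "s' \<noteq> 0"
  moreover have "sqrt (c ^ 4) = c\<^sup>2" using real_sqrt_abs[of "c\<^sup>2"] by simp
  ultimately show ?thesis
    using nz by (simp add: sqratio_def chordal_e_def sqrt_one_plus_power4_div)
next
  assume "s \<noteq> 0" "s' = 0"
  moreover have "sqrt (c' ^ 4) = c'\<^sup>2" using real_sqrt_abs[of "c'\<^sup>2"] by simp
  ultimately show ?thesis
    using nz' by (simp add: sqratio_def chordal_e_def sqrt_one_plus_power4_div)
next
  assume ne: "s \<noteq> 0" "s' \<noteq> 0"
  then have "(c / s)\<^sup>2 - (c' / s')\<^sup>2 = (c\<^sup>2 * s'\<^sup>2 - c'\<^sup>2 * s\<^sup>2) / (s\<^sup>2 * s'\<^sup>2)"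
    by (simp add: power_divide field_simps)
  then show ?thesis
    using ne
    by (simp add: sqratio_def chordal_e_def chordal_def sqrt_one_plus_power4_div abs_divide)
qed

lemma power4_sum_ge_half:
  fixes c s :: real
  assumes "c\<^sup>2 + s\<^sup>2 = 1"
  shows "1 / 2 \<le> c ^ 4 + s ^ 4"
proof -
  have "1 = (c\<^sup>2 + s\<^sup>2)\<^sup>2" by (simp add: assms)
  also have "\<dots> \<le> 2 * (c ^ 4 + s ^ 4)"
    using sum_squares_bound[of "c\<^sup>2" "s\<^sup>2"] by (simp add: power2_sum)
  finally show ?thesis by simp
qed

lemma chordal_e_sqratio_le:
  assumes cs: "c\<^sup>2 + s\<^sup>2 = 1" and cs': "c'\<^sup>2 + s'\<^sup>2 = 1"
  shows "chordal_e (sqratio c s) (sqratio c' s') \<le> 2 * \<bar>c\<^sup>2 - c'\<^sup>2\<bar>"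
proof -
  have s: "s\<^sup>2 = 1 - c\<^sup>2" "s'\<^sup>2 = 1 - c'\<^sup>2" using cs cs' by linarith+
  have num: "c\<^sup>2 * s'\<^sup>2 - c'\<^sup>2 * s\<^sup>2 = c\<^sup>2 - c'\<^sup>2" unfolding s by (simp add: algebra_simps)
  have "1 / 2 = sqrt (1 / 2) * sqrt (1 / 2)" by simp
  also have "\<dots> \<le> sqrt (c ^ 4 + s ^ 4) * sqrt (c' ^ 4 + s' ^ 4)"
    by (intro mult_mono real_sqrt_le_mono power4_sum_ge_half cs cs') simp_all
  finally have "\<bar>c\<^sup>2 - c'\<^sup>2\<bar> / (sqrt (c ^ 4 + s ^ 4) * sqrt (c' ^ 4 + s' ^ 4))
      \<le> \<bar>c\<^sup>2 - c'\<^sup>2\<bar> / (1 / 2)"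
    by (intro divide_left_mono) simp_all
  moreover have "c \<noteq> 0 \<or> s \<noteq> 0" "c' \<noteq> 0 \<or> s' \<noteq> 0" using cs cs' by auto
  ultimately show ?thesis by (simp add: chordal_e_sqratio num)
qed

section \<open>Matrix polynomials\<close>

lemma cheb_mat_carrier: "S \<in> carrier_mat n n \<Longrightarrow> cheb_mat j S \<in> carrier_mat n n"
  by (induction j S rule: cheb_mat.induct) auto

lemma cheb_mat_diagonalized:
  assumes S: "S \<in> carrier_mat n n" and X: "X \<in> carrier_mat n n" and SX: "S * X = X * diagm n f"
  shows "cheb_mat j S * X = X * diagm n (\<lambda>i. cheb j (f i))"
proof (induction j rule: induct_nat_012)
  case 0
  then show ?case using S X by simp
next
  case 1
  then show ?case using SX by simp
next
  case (ge2 j)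
  note carrier = cheb_mat_carrier[OF S, of j] cheb_mat_carrier[OF S, of "Suc j"]
  have "S * cheb_mat (Suc j) S * X = S * X * diagm n (\<lambda>i. cheb (Suc j) (f i))"
    using S carrier X ge2.IH(2) by (simp add: assoc_mult_mat_dim)
  then have recurrence_term:
    "S * cheb_mat (Suc j) S * X = X * diagm n (\<lambda>i. f i * cheb (Suc j) (f i))"
    using X by (simp add: SX assoc_mult_mat_dim diagm_mult_diagm)
  have product_carrier: "S * cheb_mat (Suc j) S \<in> carrier_mat n n" using S carrier by simp
  have "cheb_mat (Suc (Suc j)) S * X = 2 \<cdot>\<^sub>m (S * cheb_mat (Suc j) S * X) - cheb_mat j S * X"
    using minus_mult_distrib_mat[of "2 \<cdot>\<^sub>m (S * cheb_mat (Suc j) S)" n n "cheb_mat j S" X n]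
      product_carrier carrier X
    by (simp add: mult_smult_assoc_mat[OF product_carrier X])
  also have "\<dots> = X * diagm n (\<lambda>i. cheb (Suc (Suc j)) (f i))"
    unfolding recurrence_term ge2.IH(1) using X
    by (intro eq_matI) (auto simp: mult_diagm_index algebra_simps simp del: index_mult_mat(1))
  finally show ?case .
qed

lemma foldr_add_smult_diagonalized:
  assumes M: "\<And>j. M j \<in> carrier_mat n n" and X: "X \<in> carrier_mat n n"
    and MX: "\<And>j. M j * X = X * diagm n (f j)"
  shows "foldr (\<lambda>j acc. acc + w j \<cdot>\<^sub>m M j) js (0\<^sub>m n n) \<in> carrier_mat n n
    \<and> foldr (\<lambda>j acc. acc + w j \<cdot>\<^sub>m M j) js (0\<^sub>m n n) * X = X * diagm n (\<lambda>i. \<Sum>j\<leftarrow>js. w j * f j i)"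
proof (induction js)
  case Nil
  then show ?case
    using X by (auto intro!: eq_matI simp: mult_diagm_index simp del: index_mult_mat(1))
next
  case (Cons j js)
  let ?F = "foldr (\<lambda>j acc. acc + w j \<cdot>\<^sub>m M j) js (0\<^sub>m n n)"
  have "(?F + w j \<cdot>\<^sub>m M j) * X = ?F * X + w j \<cdot>\<^sub>m (M j * X)"
    using Cons M X by (simp add: add_mult_distrib_mat[of _ n n _ X n] mult_smult_assoc_mat[OF M X])
  also have "\<dots> = X * diagm n (\<lambda>i. \<Sum>j\<leftarrow>j # js. w j * f j i)"
    unfolding MX Cons[THEN conjunct2] using X
    by (intro eq_matI) (auto simp: mult_diagm_index algebra_simps simp del: index_mult_mat(1))
  finally show ?case using Cons M by simp
qed

lemma psi_mat_diagonalized: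
  assumes S: "S \<in> carrier_mat n n" and X: "X \<in> carrier_mat n n" and SX: "S * X = X * diagm n f"
  shows "psi_mat d cmin cmax S \<in> carrier_mat n n"
    and "psi_mat d cmin cmax S * X = X * diagm n (\<lambda>i. psi d cmin cmax (f i))"
proof -
  have "(\<Sum>j\<leftarrow>[0..<Suc d]. rho j d * eta cmin cmax j * cheb j x) = psi d cmin cmax x" for x
    unfolding psi_def interv_sum_list_conv_sum_set_nat
    by (simp add: atLeast0LessThan flip: lessThan_Suc_atMost)
  then show "psi_mat d cmin cmax S \<in> carrier_mat n n"
    and "psi_mat d cmin cmax S * X = X * diagm n (\<lambda>i. psi d cmin cmax (f i))"
    using foldr_add_smult_diagonalized[where M = "\<lambda>j. cheb_mat j S" and f = "\<lambda>j i. cheb j (f i)"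
        and w = "\<lambda>j. rho j d * eta cmin cmax j" and js = "[0..<Suc d]",
        OF cheb_mat_carrier[OF S] X cheb_mat_diagonalized[OF S X SX]] S
    unfolding psi_mat_def by (simp_all del: upt_Suc)
qed

section \<open>Column blocks\<close>

lemma cols_first_dim [simp]: "dim_row (cols_first p X) = dim_row X" "dim_col (cols_first p X) = p"
  by (simp_all add: cols_first_def)

lemma cols_rest_dim [simp]:
  "dim_row (cols_rest p X) = dim_row X" "dim_col (cols_rest p X) = dim_col X - p"
  by (simp_all add: cols_rest_def)

lemma col_cols_first: "j < p \<Longrightarrow> p \<le> dim_col X \<Longrightarrow> col (cols_first p X) j = col X j"
  by (rule eq_vecI) (auto simp: cols_first_def)

lemma col_cols_rest: "j < dim_col X - p \<Longrightarrow> col (cols_rest p X) j = col X (j + p)"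
  by (rule eq_vecI) (auto simp: cols_rest_def)

lemma mult_cols_first:
  "dim_col M = dim_row X \<Longrightarrow> p \<le> dim_col X \<Longrightarrow> M * cols_first p X = cols_first p (M * X)"
  by (rule eq_matI) (simp_all add: col_cols_first, simp add: cols_first_def)

lemma mult_cols_rest: "dim_col M = dim_row X \<Longrightarrow> M * cols_rest p X = cols_rest p (M * X)"
  by (rule eq_matI) (simp_all add: col_cols_rest, simp add: cols_rest_def)

lemma cols_first_mult_diagm:
  "X \<in> carrier_mat m n \<Longrightarrow> p \<le> n \<Longrightarrow> cols_first p (X * diagm n f) = cols_first p X * diagm p f"
  by (rule eq_matI)
    (auto simp: cols_first_def mult_diagm_index[of _ m] simp del: index_mult_mat(1))

lemma cols_rest_mult_diagm:
  "X \<in> carrier_mat m n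
    \<Longrightarrow> cols_rest p (X * diagm n f) = cols_rest p X * diagm (n - p) (\<lambda>i. f (i + p))"
  by (rule eq_matI)
    (auto simp: cols_rest_def mult_diagm_index[of _ m] simp del: index_mult_mat(1))

lemma cols_first_rest_mult_transpose:
  assumes "p \<le> dim_col X"
  shows "cols_first p X * (cols_first p X)\<^sup>T + cols_rest p X * (cols_rest p X)\<^sup>T = X * X\<^sup>T"
proof (rule eq_matI)
  fix i j assume "i < dim_row (X * X\<^sup>T)" "j < dim_col (X * X\<^sup>T)"
  then have ij: "i < dim_row X" "j < dim_row X" by auto
  let ?x = "\<lambda>k. X $$ (i, k) * X $$ (j, k)"
  have "(\<Sum>k = 0..<p. ?x k) + (\<Sum>k = 0..<dim_col X - p. ?x (k + p)) = (\<Sum>k = 0..<dim_col X. ?x k)"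
    using assms sum.shift_bounds_nat_ivl[of ?x 0 p "dim_col X - p"]
      sum.atLeastLessThan_concat[of 0 p "dim_col X" ?x]
    by simp
  then show "(cols_first p X * (cols_first p X)\<^sup>T + cols_rest p X * (cols_rest p X)\<^sup>T) $$ (i, j)
      = (X * X\<^sup>T) $$ (i, j)"
    using ij by (simp add: cols_first_def cols_rest_def scalar_prod_def)
qed simp_all

lemma congruence_index:
  fixes Y Z M :: "'a :: semiring_0 mat"
  assumes "dim_row Y = dim_row M" "dim_row Z = dim_col M" "i < dim_col Y" "j < dim_col Z"
  shows "(Y\<^sup>T * M * Z) $$ (i, j) = col Y i \<bullet> (M *\<^sub>v col Z j)"
  using assms
  by (simp add: assoc_mult_mat_dim col_mult2[OF carrier_matI carrier_matI])

lemma congruence_blocks: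
  assumes X: "X \<in> carrier_mat n n" and M: "M \<in> carrier_mat n n" and p: "p \<le> n"
    and XMX: "X\<^sup>T * M * X = diagm n f"
  shows "(cols_first p X)\<^sup>T * M * cols_first p X = diagm p f"
    and "(cols_first p X)\<^sup>T * M * cols_rest p X = 0\<^sub>m p (n - p)"
    and "(cols_rest p X)\<^sup>T * M * cols_first p X = 0\<^sub>m (n - p) p"
    and "(cols_rest p X)\<^sup>T * M * cols_rest p X = diagm (n - p) (\<lambda>i. f (i + p))"
proof -
  have "col X i \<bullet> (M *\<^sub>v col X j) = (if i = j then f i else 0)" if "i < n" "j < n" for i j
    using congruence_index[of X M X i j] X M that by (simp add: XMX)
  then show "(cols_first p X)\<^sup>T * M * cols_first p X = diagm p f"
    "(cols_first p X)\<^sup>T * M * cols_rest p X = 0\<^sub>m p (n - p)"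
    "(cols_rest p X)\<^sup>T * M * cols_first p X = 0\<^sub>m (n - p) p"
    "(cols_rest p X)\<^sup>T * M * cols_rest p X = diagm (n - p) (\<lambda>i. f (i + p))"
    using X M p
    by (auto intro!: eq_matI simp: congruence_index col_cols_first col_cols_rest
        simp del: index_mult_mat(1))
qed

section \<open>Bases orthonormal in the inner product of a matrix\<close>

locale H_orthonormal_basis =
  fixes H X :: "real mat" and n p :: nat
  assumes H_carrier: "H \<in> carrier_mat n n" and X_carrier: "X \<in> carrier_mat n n"
    and X_orthonormal: "X\<^sup>T * H * X = 1\<^sub>m n" and p_le_n: "p \<le> n"
begin

abbreviation "Xp \<equiv> cols_first p X"
abbreviation "Xperp \<equiv> cols_rest p X"

lemma dims [simp]: "dim_row X = n" "dim_col X = n" "dim_row H = n" "dim_col H = n"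
  using X_carrier H_carrier by auto

lemma blocks_orthonormal:
  "Xp\<^sup>T * H * Xp = 1\<^sub>m p" "Xperp\<^sup>T * H * Xp = 0\<^sub>m (n - p) p"
  "Xp\<^sup>T * H * Xperp = 0\<^sub>m p (n - p)" "Xperp\<^sup>T * H * Xperp = 1\<^sub>m (n - p)"
  using congruence_blocks[OF X_carrier H_carrier p_le_n, of "\<lambda>_. 1"]
  by (simp_all add: X_orthonormal)

lemma X_mult_transpose_mult_H: "X * X\<^sup>T * H = 1\<^sub>m n"
  using mat_mult_left_right_inverse[of "X\<^sup>T * H" n X] H_carrier X_carrier X_orthonormal
  by (simp add: assoc_mult_mat_dim)

lemma invertible_H: "invertible_mat H"
proof (rule invertible_mat_right_inverse[OF H_carrier])
  show XXT_carrier: "X * X\<^sup>T \<in> carrier_mat n n" using X_carrier by simp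
  show "H * (X * X\<^sup>T) = 1\<^sub>m n"
    by (rule mat_mult_left_right_inverse[OF XXT_carrier H_carrier X_mult_transpose_mult_H])
qed

lemma block_expansion:
  assumes "Y \<in> carrier_mat n k"
  shows "Y = Xp * (Xp\<^sup>T * H * Y) + Xperp * (Xperp\<^sup>T * H * Y)"
proof -
  have "Xp * (Xp\<^sup>T * H * Y) + Xperp * (Xperp\<^sup>T * H * Y) = (Xp * Xp\<^sup>T + Xperp * Xperp\<^sup>T) * H * Y"
    using assms by (simp add: add_mult_distrib_mat_dim assoc_mult_mat_dim)
  also have "\<dots> = Y"
    using assms p_le_n by (simp add: cols_first_rest_mult_transpose X_mult_transpose_mult_H)
  finally show ?thesis ..
qed

lemma congruence_block_expansion:
  assumes M: "M \<in> carrier_mat n n" and XMX: "X\<^sup>T * M * X = diagm n f" and Y: "Y \<in> carrier_mat n k"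
  defines "T \<equiv> Xp\<^sup>T * H * Y" and "F \<equiv> Xperp\<^sup>T * H * Y"
  shows "Y\<^sup>T * M * Y = T\<^sup>T * diagm p f * T + F\<^sup>T * diagm (n - p) (\<lambda>i. f (i + p)) * F"
proof -
  have dimTF: "dim_row T = p" "dim_col T = k" "dim_row F = n - p" "dim_col F = k"
    and dimM: "dim_row M = n" "dim_col M = n"
    using Y M by (simp_all add: T_def F_def)
  have carrier: "Xp * T \<in> carrier_mat n k" "Xperp * F \<in> carrier_mat n k"
    by (rule carrier_matI; simp add: dimTF)+
  have "Y\<^sup>T * M * Y = (Xp * T + Xperp * F)\<^sup>T * M * (Xp * T + Xperp * F)"
    unfolding T_def F_def using block_expansion[OF Y] by simp
  also have "\<dots> = T\<^sup>T * (Xp\<^sup>T * M * Xp) * T + F\<^sup>T * (Xperp\<^sup>T * M * Xp) * T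
      + (T\<^sup>T * (Xp\<^sup>T * M * Xperp) * F + F\<^sup>T * (Xperp\<^sup>T * M * Xperp) * F)"
    by (simp add: transpose_add[OF carrier] transpose_mult_dim add_mult_distrib_mat_dim
        mult_add_distrib_mat_dim assoc_mult_mat_dim dimTF dimM)
  also have "\<dots> = T\<^sup>T * diagm p f * T + F\<^sup>T * diagm (n - p) (\<lambda>i. f (i + p)) * F"
    unfolding congruence_blocks[OF X_carrier M p_le_n XMX]
    by (simp add: dimTF right_add_zero_mat[OF carrier_matI] left_add_zero_mat[OF carrier_matI])
  finally show ?thesis .
qed

lemma minv_H_mult_diagonalized:
  assumes D: "D \<in> carrier_mat n n" and XDX: "X\<^sup>T * D * X = diagm n f"
  shows "minv H * D \<in> carrier_mat n n" and "minv H * D * X = X * diagm n f"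
proof -
  note inv = minv_inverse[OF H_carrier invertible_H]
  show "minv H * D \<in> carrier_mat n n" using D inv(1) by simp
  have "minv H * D * X = X * X\<^sup>T * H * (minv H * D * X)"
    using D inv(1) unfolding X_mult_transpose_mult_H by simp
  also have "\<dots> = X * (X\<^sup>T * (H * minv H) * D * X)"
    using D inv(1) by (simp add: assoc_mult_mat_dim)
  finally show "minv H * D * X = X * diagm n f"
    using X_carrier by (simp add: inv(2) XDX)
qed

lemma ritz_value_distance:
  assumes M: "M \<in> carrier_mat n n" and XMX: "X\<^sup>T * M * X = diagm n a"
    and a: "\<And>i. i < n \<Longrightarrow> 0 \<le> a i \<and> a i \<le> 1"
    and Y: "Y \<in> carrier_mat n p" "Y\<^sup>T * H * Y = 1\<^sub>m p" "Y\<^sup>T * M * Y = diagm p ah"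
    and \<pi>: "bij_betw \<pi> {..<p} {..<p}"
    and mono: "\<And>i j. i < p \<Longrightarrow> j < p \<Longrightarrow> a i < a j \<Longrightarrow> ah (\<pi> i) \<le> ah (\<pi> j)"
    and i: "i < p"
  shows "\<bar>ah (\<pi> i) - a i\<bar> \<le> (mnorm (Xperp\<^sup>T * H * Y))\<^sup>2"
proof (rule ritz_value_perturbation[where T = "Xp\<^sup>T * H * Y" and b = "\<lambda>i. a (i + p)"])
  let ?T = "Xp\<^sup>T * H * Y" and ?F = "Xperp\<^sup>T * H * Y"
  show T: "?T \<in> carrier_mat p p" and F: "?F \<in> carrier_mat (n - p) p"
    using Y(1) by (auto intro!: carrier_matI)
  show "?T\<^sup>T * ?T + ?F\<^sup>T * ?F = 1\<^sub>m p"
    using congruence_block_expansion[OF H_carrier _ Y(1), of "\<lambda>_. 1"] T F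
    by (simp add: X_orthonormal Y(2) right_mult_one_mat[of "?T\<^sup>T"] right_mult_one_mat[of "?F\<^sup>T"])
  show "?T\<^sup>T * diagm p a * ?T + ?F\<^sup>T * diagm (n - p) (\<lambda>i. a (i + p)) * ?F = diagm p ah"
    using congruence_block_expansion[OF M XMX Y(1)] by (simp add: Y(3))
qed (use a \<pi> mono i p_le_n in auto)

end

section \<open>Subspace iteration\<close>

lemma same_range_coordinates:
  fixes G L Y C D :: "real mat"
  assumes G: "G \<in> carrier_mat n p" and L: "L \<in> carrier_mat p n" "L * G = 1\<^sub>m p"
    and Y: "Y \<in> carrier_mat n p" and C: "C \<in> carrier_mat p p" "invertible_mat C"
    and D: "D \<in> carrier_mat p p" and eq: "G * C = Y * D"
  shows "Y = G * (L * Y)" and "invertible_mat (L * Y)"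
proof -
  note C' = minv_inverse[OF C]
  have "L * Y * D = L * G * C" using G L(1) Y C(1) D by (simp add: assoc_mult_mat_dim eq)
  then have LYD: "L * Y * D = C" using C(1) by (simp add: L(2))
  have LY: "L * Y \<in> carrier_mat p p" using L(1) Y by simp
  show "invertible_mat (L * Y)"
  proof (rule invertible_mat_right_inverse[OF LY])
    show "D * minv C \<in> carrier_mat p p" using D C'(1) by simp
    have "L * Y * (D * minv C) = L * Y * D * minv C" using LY D C'(1) by (simp add: assoc_mult_mat)
    then show "L * Y * (D * minv C) = 1\<^sub>m p" by (simp add: LYD C'(2))
  qed
  have "minv C * (L * Y) * D = 1\<^sub>m p"
    using assoc_mult_mat[OF C'(1) LY D] by (simp add: LYD C'(3))
  then have "D * (minv C * (L * Y)) = 1\<^sub>m p"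
    by (rule mat_mult_left_right_inverse[rotated 2]) (use LY D C'(1) in simp_all)
  then have "Y = Y * (D * (minv C * (L * Y)))" using Y by simp
  also have "\<dots> = G * C * (minv C * (L * Y))"
    unfolding eq using Y D C'(1) L(1) by (simp add: assoc_mult_mat_dim)
  also have "\<dots> = G * ((C * minv C) * (L * Y))"
    using G C(1) C'(1) L(1) Y by (simp add: assoc_mult_mat_dim)
  finally show "Y = G * (L * Y)" by (simp add: C'(2) left_mult_one_mat[OF LY])
qed

locale subspace_iteration = H_orthonormal_basis +
  fixes P :: "real mat" and \<gamma> :: "nat \<Rightarrow> real" and \<mu> \<nu> :: real
    and Xk Xhat :: "nat \<Rightarrow> real mat"
  assumes P_carrier: "P \<in> carrier_mat n n" and P_diagonalized: "P * X = X * diagm n \<gamma>"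
    and \<mu>_pos: "0 < \<mu>" and \<mu>_le: "\<And>i. i < p \<Longrightarrow> \<mu> \<le> \<gamma> i"
    and \<nu>_nonneg: "0 \<le> \<nu>" and le_\<nu>: "\<And>i. p \<le> i \<Longrightarrow> i < n \<Longrightarrow> \<bar>\<gamma> i\<bar> \<le> \<nu>"
    and X0_carrier: "Xk 0 \<in> carrier_mat n p" and X0_nonsingular: "invertible_mat (Xp\<^sup>T * H * Xk 0)"
    and Xhat_carrier: "\<And>k. Xhat k \<in> carrier_mat n p"
    and Xhat_orthonormal: "\<And>k. (Xhat k)\<^sup>T * H * Xhat k = 1\<^sub>m p"
    and Xk_range: "\<And>k. \<exists>R\<in>carrier_mat p p. Xk k = Xhat k * R"
    and Xk_Suc: "\<And>k. Xk (Suc k) = P * Xhat k"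
begin

definition E :: "nat \<Rightarrow> real mat" where
  "E k = diagm (n - p) (\<lambda>i. \<gamma> (i + p) ^ k) * Xperp\<^sup>T * H * Xk 0 * minv (Xp\<^sup>T * H * Xk 0)
    * diagm p (\<lambda>i. 1 / \<gamma> i ^ k)"

abbreviation "graph k \<equiv> Xp + Xperp * E k"
abbreviation "coords k \<equiv> Xp\<^sup>T * H * Xhat k"
abbreviation "subspace_dist k \<equiv> mnorm (Xperp\<^sup>T * H * Xhat k)"

lemma X0_coords_carrier: "Xp\<^sup>T * H * Xk 0 \<in> carrier_mat p p"
  using X0_carrier by (auto intro!: carrier_matI)

lemma coords_carrier: "coords k \<in> carrier_mat p p"
  using Xhat_carrier[of k] by (auto intro!: carrier_matI)

lemma E_0: "E 0 = Xperp\<^sup>T * H * Xk 0 * minv (Xp\<^sup>T * H * Xk 0)"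
  using X0_carrier minv_inverse(1)[OF X0_coords_carrier X0_nonsingular] by (simp add: E_def)

lemma E_eq: "E k = diagm (n - p) (\<lambda>i. \<gamma> (i + p) ^ k) * E 0 * diagm p (\<lambda>i. 1 / \<gamma> i ^ k)"
  unfolding E_0 E_def
  using X0_carrier minv_inverse(1)[OF X0_coords_carrier X0_nonsingular]
  by (simp add: assoc_mult_mat_dim)

lemma E_carrier: "E k \<in> carrier_mat (n - p) p"
  by (rule carrier_matI) (simp_all add: E_def)

lemma E_dim [simp]: "dim_row (E k) = n - p" "dim_col (E k) = p"
  using E_carrier[of k] by auto

lemma graph_carrier: "graph k \<in> carrier_mat n p"
  by (rule carrier_matI) simp_all

lemma \<gamma>_pos: "i < p \<Longrightarrow> 0 < \<gamma> i"
  using \<mu>_pos \<mu>_le[of i] by linarith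

lemma E_Suc: "E (Suc k) * diagm p \<gamma> = diagm (n - p) (\<lambda>i. \<gamma> (i + p)) * E k"
proof -
  have "diagm p (\<lambda>i. 1 / \<gamma> i ^ Suc k) * diagm p \<gamma> = diagm p (\<lambda>i. 1 / \<gamma> i ^ k)"
    unfolding diagm_mult_diagm by (rule diagm_cong) (use \<gamma>_pos in force)
  moreover have "diagm (n - p) (\<lambda>i. \<gamma> (i + p) ^ Suc k)
      = diagm (n - p) (\<lambda>i. \<gamma> (i + p)) * diagm (n - p) (\<lambda>i. \<gamma> (i + p) ^ k)"
    by (simp add: diagm_mult_diagm)
  ultimately show ?thesis
    unfolding E_eq[of "Suc k"] E_eq[of k] by (simp add: assoc_mult_mat_dim del: power_Suc)
qed

lemma P_mult_graph: "P * graph k = graph (Suc k) * diagm p \<gamma>"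
proof -
  have "P * Xp = Xp * diagm p \<gamma>" "P * Xperp = Xperp * diagm (n - p) (\<lambda>i. \<gamma> (i + p))"
    using P_carrier p_le_n by (simp_all add: mult_cols_first mult_cols_rest P_diagonalized
        cols_first_mult_diagm[OF X_carrier] cols_rest_mult_diagm[OF X_carrier])
  then have "P * graph k = Xp * diagm p \<gamma> + Xperp * (diagm (n - p) (\<lambda>i. \<gamma> (i + p)) * E k)"
    using P_carrier by (simp add: mult_add_distrib_mat_dim flip: assoc_mult_mat_dim)
  then show ?thesis
    by (simp add: add_mult_distrib_mat_dim assoc_mult_mat_dim flip: E_Suc)
qed

lemma graph_coords:
  shows "Xp\<^sup>T * H * graph k = 1\<^sub>m p" and "Xperp\<^sup>T * H * graph k = E k"
proof -
  have "Xp\<^sup>T * H * graph k = Xp\<^sup>T * H * Xp + Xp\<^sup>T * H * Xperp * E k"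
    "Xperp\<^sup>T * H * graph k = Xperp\<^sup>T * H * Xp + Xperp\<^sup>T * H * Xperp * E k"
    by (simp_all add: mult_add_distrib_mat_dim assoc_mult_mat_dim)
  then show "Xp\<^sup>T * H * graph k = 1\<^sub>m p" "Xperp\<^sup>T * H * graph k = E k"
    by (simp_all add: blocks_orthonormal left_add_zero_mat[OF E_carrier])
qed

lemma X0_eq_graph: "Xk 0 = graph 0 * (Xp\<^sup>T * H * Xk 0)"
proof -
  let ?C = "Xp\<^sup>T * H * Xk 0"
  note C' = minv_inverse[OF X0_coords_carrier X0_nonsingular]
  have "E 0 * ?C = Xperp\<^sup>T * H * Xk 0 * (minv ?C * ?C)"
    unfolding E_0 using X0_carrier X0_coords_carrier C'(1) by (simp add: assoc_mult_mat_dim)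
  then have "E 0 * ?C = Xperp\<^sup>T * H * Xk 0"
    using X0_carrier by (simp add: C'(3))
  then have "graph 0 * ?C = Xp * ?C + Xperp * (Xperp\<^sup>T * H * Xk 0)"
    using X0_carrier by (simp add: add_mult_distrib_mat_dim assoc_mult_mat_dim[of Xperp])
  then show ?thesis using block_expansion[OF X0_carrier] by simp
qed

lemma Xhat_eq_graph_if:
  assumes "C \<in> carrier_mat p p" "invertible_mat C" "Xk k = graph k * C"
  shows "Xhat k = graph k * coords k" and "invertible_mat (coords k)"
proof -
  have L: "Xp\<^sup>T * H \<in> carrier_mat p n" by (rule carrier_matI) simp_all
  obtain R where R: "R \<in> carrier_mat p p" and eq: "graph k * C = Xhat k * R"
    using assms(3) Xk_range[of k] by auto
  show "Xhat k = graph k * coords k" and "invertible_mat (coords k)"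
    by (rule same_range_coordinates[OF graph_carrier L graph_coords(1) Xhat_carrier assms(1,2)
          R eq])+
qed

lemma Xk_eq_graph: "\<exists>C. C \<in> carrier_mat p p \<and> invertible_mat C \<and> Xk k = graph k * C"
proof (induction k)
  case 0
  then show ?case using X0_coords_carrier X0_nonsingular X0_eq_graph by blast
next
  case (Suc k)
  then have Xhat_k: "Xhat k = graph k * coords k" and inv: "invertible_mat (coords k)"
    using Xhat_eq_graph_if by blast+
  have "Xk (Suc k) = P * (graph k * coords k)" by (simp add: Xk_Suc flip: Xhat_k)
  also have "\<dots> = P * graph k * coords k"
    using assoc_mult_mat[OF P_carrier graph_carrier coords_carrier] by simp
  also have "\<dots> = graph (Suc k) * (diagm p \<gamma> * coords k)"
    unfolding P_mult_graph by (rule assoc_mult_mat[OF graph_carrier diagm_carrier coords_carrier])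
  finally have "Xk (Suc k) = graph (Suc k) * (diagm p \<gamma> * coords k)" .
  moreover have "invertible_mat (diagm p \<gamma> * coords k)"
    using \<gamma>_pos
    by (intro invertible_mat_mult[OF diagm_carrier _ coords_carrier inv] invertible_diagm) force
  moreover have "diagm p \<gamma> * coords k \<in> carrier_mat p p"
    by (rule mult_carrier_mat[OF diagm_carrier coords_carrier])
  ultimately show ?case by blast
qed

lemma Xhat_eq_graph: "Xhat k = graph k * coords k"
  using Xk_eq_graph Xhat_eq_graph_if by blast

lemma Xperp_coords: "Xperp\<^sup>T * H * Xhat k = E k * coords k"
proof -
  have "Xperp\<^sup>T * H * Xhat k = Xperp\<^sup>T * H * (graph k * coords k)" by (simp flip: Xhat_eq_graph)
  also have "\<dots> = Xperp\<^sup>T * H * graph k * coords k"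
    by (rule assoc_mult_mat[symmetric, OF _ graph_carrier coords_carrier])
      (auto intro: carrier_matI)
  finally show ?thesis by (simp only: graph_coords)
qed

lemma coords_orthonormal: "(coords k)\<^sup>T * coords k + (E k * coords k)\<^sup>T * (E k * coords k) = 1\<^sub>m p"
  using congruence_block_expansion[OF H_carrier _ Xhat_carrier, of "\<lambda>_. 1" k] Xhat_carrier[of k]
  unfolding Xperp_coords by (simp add: X_orthonormal Xhat_orthonormal)

theorem Xhat_factorization:
  "\<exists>N W. N \<in> carrier_mat p p \<and> sym_pos_def N \<and> N * N * (1\<^sub>m p + (E k)\<^sup>T * E k) = 1\<^sub>m p
    \<and> W \<in> carrier_mat p p \<and> orthonormal_cols W \<and> Xhat k = graph k * N * W"
proof -
  have M: "1\<^sub>m p + (E k)\<^sup>T * E k \<in> carrier_mat p p" by (auto intro: carrier_matI)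
  obtain N W where NW: "N \<in> carrier_mat p p" "sym_pos_def N"
    "N * N * (1\<^sub>m p + (E k)\<^sup>T * E k) = 1\<^sub>m p"
    "W \<in> carrier_mat p p" "orthonormal_cols W" and "coords k = N * W"
    using polar_factor[OF M graph_gram_sym_pos_def[OF E_carrier] coords_carrier]
      graph_gram[OF E_carrier coords_carrier] coords_orthonormal by metis
  then have "Xhat k = graph k * N * W"
    using assoc_mult_mat[OF graph_carrier[of k] NW(1,4)] Xhat_eq_graph[of k] by simp
  then show ?thesis using NW by blast
qed

theorem mnorm_E_le: "mnorm (E k) \<le> (\<nu> / \<mu>) ^ k * mnorm (E 0)"
proof -
  have "mnorm (E k) \<le> mnorm (diagm (n - p) (\<lambda>i. \<gamma> (i + p) ^ k)) * mnorm (E 0)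
      * mnorm (diagm p (\<lambda>i. 1 / \<gamma> i ^ k))"
    unfolding E_eq[of k]
    by (rule order_trans[OF mnorm_mult_le mult_right_mono[OF mnorm_mult_le]]) simp_all
  also have "\<dots> \<le> \<nu> ^ k * mnorm (E 0) * (1 / \<mu> ^ k)"
  proof (intro mult_mono mnorm_diagm_le)
    show "\<bar>\<gamma> (i + p) ^ k\<bar> \<le> \<nu> ^ k" if "i < n - p" for i
      using le_\<nu>[of "i + p"] that by (simp add: power_abs power_mono)
    show "\<bar>1 / \<gamma> i ^ k\<bar> \<le> 1 / \<mu> ^ k" if "i < p" for i
      using \<mu>_le[OF that] \<gamma>_pos[OF that] \<mu>_pos by (simp add: frac_le power_mono)
  qed (use \<nu>_nonneg \<mu>_pos in simp_all)
  finally show ?thesis by (simp add: power_divide)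
qed

theorem subspace_dist_eq: "subspace_dist k = mnorm (E k) / sqrt (1 + (mnorm (E k))\<^sup>2)"
  unfolding Xperp_coords
  by (rule mnorm_orthonormal_graph[OF E_carrier coords_carrier coords_orthonormal])

corollary subspace_dist_le: "subspace_dist k \<le> (\<nu> / \<mu>) ^ k * mnorm (E 0)"
proof -
  have "mnorm (E k) / sqrt (1 + (mnorm (E k))\<^sup>2) \<le> mnorm (E k) / 1"
    by (intro divide_left_mono) (simp_all add: add_pos_nonneg)
  then show ?thesis using mnorm_E_le[of k] by (simp add: subspace_dist_eq)
qed

end

section \<open>Subspace iteration for the generalized singular value decomposition\<close>

lemma gsvd_gram:
  fixes A X U SA :: "real mat"
  assumes A: "A \<in> carrier_mat m n" and X: "X \<in> carrier_mat n n"
    and U: "U \<in> carrier_mat m m" "orthonormal_cols U"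
    and SA: "U\<^sup>T * A * X = SA" "SA\<^sup>T * SA = diagm n f"
  shows "X\<^sup>T * (A\<^sup>T * A) * X = diagm n f"
proof -
  have "diagm n f = X\<^sup>T * (A\<^sup>T * ((U * U\<^sup>T) * (A * X)))"
    using A X U(1) by (simp add: transpose_mult_dim assoc_mult_mat_dim flip: SA)
  then show ?thesis
    using A X by (simp add: orthonormal_cols_mult_transpose[OF U(2,1)] assoc_mult_mat_dim)
qed

lemma ritz_gram:
  fixes A Q Q1 Abar Ubar Xbar :: "real mat"
  assumes A: "A \<in> carrier_mat m n" and Q: "Q \<in> carrier_mat n p"
    and Q1: "Q1 \<in> carrier_mat m p" "orthonormal_cols Q1" and AQ: "A * Q = Q1 * Abar"
    and U: "Ubar \<in> carrier_mat p p" "orthonormal_cols Ubar"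
    and X: "Xbar \<in> carrier_mat p p" "invertible_mat Xbar"
    and Abar: "Abar = Ubar * diagm p f * minv Xbar"
  shows "(Q * Xbar)\<^sup>T * (A\<^sup>T * A) * (Q * Xbar) = diagm p (\<lambda>i. (f i)\<^sup>2)"
proof -
  note X' = minv_inverse[OF X]
  have "A * (Q * Xbar) = Q1 * Abar * Xbar"
    using A Q X(1) by (simp flip: AQ)
  also have "\<dots> = Q1 * (Ubar * (diagm p f * (minv Xbar * Xbar)))"
    unfolding Abar using Q1(1) U(1) X(1) X'(1) by (simp add: assoc_mult_mat_dim)
  finally have A_Xhat: "A * (Q * Xbar) = Q1 * Ubar * diagm p f"
    using Q1(1) U(1) by (simp add: X'(3) assoc_mult_mat_dim)
  have "orthonormal_cols (Q1 * Ubar)" by (rule orthonormal_cols_mult[OF Q1 U])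
  then have orth: "(Q1 * Ubar)\<^sup>T * (Q1 * Ubar) = 1\<^sub>m p"
    using U(1) by (simp add: orthonormal_cols_def)
  have "(Q * Xbar)\<^sup>T * (A\<^sup>T * A) * (Q * Xbar) = (A * (Q * Xbar))\<^sup>T * (A * (Q * Xbar))"
    using A Q X(1) by (simp add: transpose_mult_dim assoc_mult_mat_dim)
  also have "\<dots> = diagm p f * ((Q1 * Ubar)\<^sup>T * (Q1 * Ubar)) * diagm p f"
    unfolding A_Xhat using Q1(1) U(1) by (simp add: transpose_mult_dim assoc_mult_mat_dim)
  finally show ?thesis
    unfolding orth by (simp add: diagm_mult_diagm power2_eq_square)
qed

lemma congruence_add_diagonalized:
  assumes X: "X \<in> carrier_mat n k" and M: "M \<in> carrier_mat n n" "X\<^sup>T * M * X = diagm k f"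
    and N: "N \<in> carrier_mat n n" "X\<^sup>T * N * X = diagm k g"
  shows "X\<^sup>T * (M + N) * X = diagm k (\<lambda>i. f i + g i)"
    and "X\<^sup>T * (M - N) * X = diagm k (\<lambda>i. f i - g i)"
proof -
  have "X\<^sup>T * (M + N) * X = X\<^sup>T * M * X + X\<^sup>T * N * X"
    using X M(1) N(1) by (simp add: mult_add_distrib_mat_dim add_mult_distrib_mat_dim)
  then show "X\<^sup>T * (M + N) * X = diagm k (\<lambda>i. f i + g i)" by (simp add: M(2) N(2) diagm_add)
  have "X\<^sup>T * (M - N) * X = X\<^sup>T * M * X - X\<^sup>T * N * X"
    using X M(1) N(1)
    by (simp add: mult_minus_distrib_mat[of _ k n _ n] minus_mult_distrib_mat[of _ k n _ X k])
  then show "X\<^sup>T * (M - N) * X = diagm k (\<lambda>i. f i - g i)" by (simp add: M(2) N(2) diagm_minus)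
qed

lemma mult_invertible_range:
  fixes Q X R :: "real mat"
  assumes Q: "Q \<in> carrier_mat m n" and X: "X \<in> carrier_mat n n" "invertible_mat X"
    and R: "R \<in> carrier_mat n k"
  shows "\<exists>R'\<in>carrier_mat n k. Q * R = Q * X * R'"
proof
  note X' = minv_inverse[OF X]
  show "minv X * R \<in> carrier_mat n k" using X'(1) R by simp
  have "Q * X * (minv X * R) = Q * (X * minv X * R)"
    using Q X(1) X'(1) R by (simp add: assoc_mult_mat_dim)
  then show "Q * R = Q * X * (minv X * R)" using R by (simp add: X'(2))
qed

text \<open>\<open>G\<^sub>A\<close> and \<open>G\<^sub>B\<close> stand for \<open>A\<^sup>T A\<close> and \<open>B\<^sup>T B\<close>: the QR and GSVD factors of a step enter only
  through the Gram matrices of \<open>Xhat k\<close> and the inclusion of the range of \<open>Xk k\<close> in that of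
  \<open>Xhat k\<close>.\<close>
locale gsvd_subspace_iteration =
  fixes G\<^sub>A G\<^sub>B H X P :: "real mat" and n p d :: nat and c s \<gamma> :: "nat \<Rightarrow> real" and cmin cmax :: real
    and Xk Xhat :: "nat \<Rightarrow> real mat" and ch sh :: "nat \<Rightarrow> nat \<Rightarrow> real"
  assumes G\<^sub>A: "G\<^sub>A \<in> carrier_mat n n" "X\<^sup>T * G\<^sub>A * X = diagm n (\<lambda>i. (c i)\<^sup>2)"
    and G\<^sub>B: "G\<^sub>B \<in> carrier_mat n n" "X\<^sup>T * G\<^sub>B * X = diagm n (\<lambda>i. (s i)\<^sup>2)"
    and X_carrier: "X \<in> carrier_mat n n" and H_eq: "H = G\<^sub>A + G\<^sub>B"
    and cs: "\<And>i. i < n \<Longrightarrow> 0 \<le> c i \<and> (c i)\<^sup>2 + (s i)\<^sup>2 = 1"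
    and interval: "0 \<le> cmin" "cmin \<le> cmax" "cmax \<le> 1"
    and P_eq: "P = psi_mat d cmin cmax (minv H * (G\<^sub>A - G\<^sub>B))"
    and \<gamma>_eq: "\<gamma> = (\<lambda>i. psi d cmin cmax (lmap (c i)))"
    and p: "0 < p" "p < n" and gap: "\<gamma> p < \<gamma> (p - 1)"
    and \<gamma>_ge: "\<And>i. i < p \<Longrightarrow> \<gamma> (p - 1) \<le> \<gamma> i" and \<gamma>_le: "\<And>i. p \<le> i \<Longrightarrow> i < n \<Longrightarrow> \<gamma> i \<le> \<gamma> p"
    and X0_carrier: "Xk 0 \<in> carrier_mat n p"
    and X0_nonsingular: "invertible_mat ((cols_first p X)\<^sup>T * H * Xk 0)"
    and Xhat_carrier: "\<And>k. Xhat k \<in> carrier_mat n p"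
    and ritz_A: "\<And>k. (Xhat k)\<^sup>T * G\<^sub>A * Xhat k = diagm p (\<lambda>i. (ch k i)\<^sup>2)"
    and ritz_B: "\<And>k. (Xhat k)\<^sup>T * G\<^sub>B * Xhat k = diagm p (\<lambda>i. (sh k i)\<^sup>2)"
    and chsh: "\<And>k i. i < p \<Longrightarrow> 0 \<le> ch k i \<and> (ch k i)\<^sup>2 + (sh k i)\<^sup>2 = 1"
    and Xk_range: "\<And>k. \<exists>R\<in>carrier_mat p p. Xk k = Xhat k * R"
    and Xk_Suc: "\<And>k. Xk (Suc k) = P * Xhat k"
begin

lemma c_square: "i < n \<Longrightarrow> 0 \<le> (c i)\<^sup>2 \<and> (c i)\<^sup>2 \<le> 1"
  using cs[of i] by (metis le_add_same_cancel1 zero_le_power2)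

lemma \<gamma>_nonneg: "i < n \<Longrightarrow> 0 \<le> \<gamma> i"
  unfolding \<gamma>_eq using c_square[of i] interval
  by (intro psi_nonneg abs_lmap_le_1) (simp_all add: abs_square_le_1)

lemma X_H_orthonormal: "X\<^sup>T * H * X = 1\<^sub>m n"
proof -
  have "diagm n (\<lambda>i. (c i)\<^sup>2 + (s i)\<^sup>2) = diagm n (\<lambda>_. 1)" by (rule diagm_cong) (simp add: cs)
  then show ?thesis unfolding H_eq by (simp add: congruence_add_diagonalized[OF X_carrier G\<^sub>A G\<^sub>B])
qed

lemma Xhat_H_orthonormal: "(Xhat k)\<^sup>T * H * Xhat k = 1\<^sub>m p"
proof -
  have "diagm p (\<lambda>i. (ch k i)\<^sup>2 + (sh k i)\<^sup>2) = diagm p (\<lambda>_. 1)"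
    by (rule diagm_cong) (simp add: chsh)
  then show ?thesis
    unfolding H_eq
    by (simp add: congruence_add_diagonalized[OF Xhat_carrier G\<^sub>A(1) ritz_A G\<^sub>B(1) ritz_B])
qed

sublocale H_orthonormal_basis H X n p
  using X_carrier X_H_orthonormal p G\<^sub>A(1) G\<^sub>B(1) by unfold_locales (simp_all add: H_eq)

lemma filter_diagonalized: "P \<in> carrier_mat n n" "P * X = X * diagm n \<gamma>"
proof -
  have "diagm n (\<lambda>i. (c i)\<^sup>2 - (s i)\<^sup>2) = diagm n (\<lambda>i. lmap (c i))"
  proof (rule diagm_cong)
    show "(c i)\<^sup>2 - (s i)\<^sup>2 = lmap (c i)" if "i < n" for i
      using cs[OF that] by (simp add: lmap_def)
  qed
  then have D: "G\<^sub>A - G\<^sub>B \<in> carrier_mat n n" "X\<^sup>T * (G\<^sub>A - G\<^sub>B) * X = diagm n (\<lambda>i. lmap (c i))"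
    using G\<^sub>A(1) G\<^sub>B(1)
    by (simp_all add: congruence_add_diagonalized[OF X_carrier G\<^sub>A G\<^sub>B] minus_carrier_mat)
  show "P \<in> carrier_mat n n" "P * X = X * diagm n \<gamma>"
    unfolding P_eq \<gamma>_eq by (rule psi_mat_diagonalized[OF minv_H_mult_diagonalized(1)[OF D] X_carrier
          minv_H_mult_diagonalized(2)[OF D]])+
qed

sublocale subspace_iteration H X n p P \<gamma> "\<gamma> (p - 1)" "\<gamma> p" Xk Xhat
proof
  show "0 < \<gamma> (p - 1)" "0 \<le> \<gamma> p" using \<gamma>_nonneg[of p] gap p by auto
  show "\<bar>\<gamma> i\<bar> \<le> \<gamma> p" if "p \<le> i" "i < n" for i
    using \<gamma>_le[OF that] \<gamma>_nonneg that by simp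
qed (use filter_diagonalized \<gamma>_ge X0_carrier X0_nonsingular Xhat_carrier Xhat_H_orthonormal Xk_range
    Xk_Suc in auto)

theorem chordal_ritz_value_le:
  assumes \<pi>: "bij_betw \<pi> {..<p} {..<p}"
    and mono: "\<And>i j. i < p \<Longrightarrow> j < p \<Longrightarrow> c i < c j \<Longrightarrow> ch k (\<pi> i) \<le> ch k (\<pi> j)" and i: "i < p"
  shows "chordal_e (sqratio (ch k (\<pi> i)) (sh k (\<pi> i))) (sqratio (c i) (s i))
    \<le> 2 * (subspace_dist k)\<^sup>2"
proof -
  have \<pi>_less: "\<pi> j < p" if "j < p" for j
    using \<pi> that by (auto simp: bij_betw_def)
  have "\<bar>(ch k (\<pi> i))\<^sup>2 - (c i)\<^sup>2\<bar> \<le> (subspace_dist k)\<^sup>2"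
  proof (rule ritz_value_distance[OF G\<^sub>A c_square Xhat_carrier Xhat_H_orthonormal ritz_A \<pi> _ i])
    fix j l assume jl: "j < p" "l < p" "(c j)\<^sup>2 < (c l)\<^sup>2"
    then have "c j < c l" using cs[of l] p by (auto intro: power2_less_imp_less)
    then show "(ch k (\<pi> j))\<^sup>2 \<le> (ch k (\<pi> l))\<^sup>2"
      using mono jl chsh[OF \<pi>_less] by (simp add: power_mono)
  qed
  then have "2 * \<bar>(ch k (\<pi> i))\<^sup>2 - (c i)\<^sup>2\<bar> \<le> 2 * (subspace_dist k)\<^sup>2" by simp
  with chordal_e_sqratio_le show ?thesis
    using cs[of i] chsh[OF \<pi>_less[OF i]] i p by (blast intro: order_trans less_trans)
qed

end

theorem theorem4p1:
  fixes A B U V X SA SB :: "real mat"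
    and m1 m2 n p r ngv d :: nat
    and c s :: "nat \<Rightarrow> real"
    and cmin cmax :: real
    and Xk Q R Q1 Abar Q2 Bbar Ubar Vbar Xbar :: "nat \<Rightarrow> real mat"
    and ch sh :: "nat \<Rightarrow> nat \<Rightarrow> real"
  assumes A: "A \<in> carrier_mat m1 n" and B: "B \<in> carrier_mat m2 n"
    and mn: "m1 + m2 \<ge> n"
    and fullrank: "\<forall>v \<in> carrier_vec n. A *\<^sub>v v = 0\<^sub>v m1 \<and> B *\<^sub>v v = 0\<^sub>v m2 \<longrightarrow> v = 0\<^sub>v n"
  defines "H \<equiv> transpose_mat A * A + transpose_mat B * B"
  assumes U: "U \<in> carrier_mat m1 m1" "orthonormal_cols U"
    and V: "V \<in> carrier_mat m2 m2" "orthonormal_cols V"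
    and X: "X \<in> carrier_mat n n" "invertible_mat X" "transpose_mat X * H * X = 1\<^sub>m n"
    and SA: "transpose_mat U * A * X = SA" "transpose_mat SA * SA = diagm n (\<lambda>i. (c i)\<^sup>2)"
    and SB: "transpose_mat V * B * X = SB" "transpose_mat SB * SB = diagm n (\<lambda>i. (s i)\<^sup>2)"
    and cs: "\<forall>i<n. c i \<ge> 0 \<and> s i \<ge> 0 \<and> (c i)\<^sup>2 + (s i)\<^sup>2 = 1"
    and interval: "0 \<le> cmin" "cmin \<le> cmax" "cmax \<le> 1"
  defines "S \<equiv> minv H * (transpose_mat A * A - transpose_mat B * B)"
  defines "P \<equiv> psi_mat d cmin cmax S"
  defines "\<gamma> \<equiv> (\<lambda>i. psi d cmin cmax (lmap (c i)))"
  assumes idx: "r \<le> ngv" "ngv \<le> n"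
    and grp1: "\<forall>i<r. cmin < c i \<and> c i < cmax"
    and grp2: "\<forall>i. r \<le> i \<and> i < ngv \<longrightarrow> c i = cmin \<or> c i = cmax"
    and grp3: "\<forall>i. ngv \<le> i \<and> i < n \<longrightarrow> c i < cmin \<or> cmax < c i"
    and dec1: "\<forall>i j. i \<le> j \<and> j < r \<longrightarrow> \<gamma> j \<le> \<gamma> i"
    and dec2: "\<forall>i j. r \<le> i \<and> i \<le> j \<and> j < ngv \<longrightarrow> \<gamma> j \<le> \<gamma> i"
    and dec3: "\<forall>i j. ngv \<le> i \<and> i \<le> j \<and> j < n \<longrightarrow> \<gamma> j \<le> \<gamma> i"
    and p: "ngv \<le> p" "0 < p" "p < n"
    and gap: "\<gamma> p < \<gamma> (p - 1)"
    and gamma_p_min: "\<forall>i<p. \<gamma> (p - 1) \<le> \<gamma> i"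
  defines "Xp \<equiv> cols_first p X" and "Xperp \<equiv> cols_rest p X"
  assumes X0: "Xk 0 \<in> carrier_mat n p" "full_col_rank (Xk 0)"
    and X0nonsing: "invertible_mat (transpose_mat Xp * H * Xk 0)"
    and QR: "\<forall>k. Q k \<in> carrier_mat n p \<and> orthonormal_cols (Q k) \<and>
                 R k \<in> carrier_mat p p \<and> upper_triangular (R k) \<and> Xk k = Q k * R k"
    and QRA: "\<forall>k. full_col_rank (A * Q k) \<and>
                 Q1 k \<in> carrier_mat m1 p \<and> orthonormal_cols (Q1 k) \<and>
                 Abar k \<in> carrier_mat p p \<and> upper_triangular (Abar k) \<and> A * Q k = Q1 k * Abar k"
    and QRB: "\<forall>k. full_col_rank (B * Q k) \<and>
                 Q2 k \<in> carrier_mat m2 p \<and> orthonormal_cols (Q2 k) \<and>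
                 Bbar k \<in> carrier_mat p p \<and> upper_triangular (Bbar k) \<and> B * Q k = Q2 k * Bbar k"
    and GSVDk: "\<forall>k. Ubar k \<in> carrier_mat p p \<and> orthonormal_cols (Ubar k) \<and>
                 Vbar k \<in> carrier_mat p p \<and> orthonormal_cols (Vbar k) \<and>
                 Xbar k \<in> carrier_mat p p \<and> invertible_mat (Xbar k) \<and>
                 Abar k = Ubar k * diagm p (ch k) * minv (Xbar k) \<and>
                 Bbar k = Vbar k * diagm p (sh k) * minv (Xbar k) \<and>
                 (\<forall>i<p. ch k i \<ge> 0 \<and> sh k i \<ge> 0 \<and> (ch k i)\<^sup>2 + (sh k i)\<^sup>2 = 1)"
  defines "Xhat \<equiv> (\<lambda>k. Q k * Xbar k)"
  assumes iter: "\<forall>k. Xk (Suc k) = P * Xhat k"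
  defines "E \<equiv> (\<lambda>k::nat. diagm (n - p) (\<lambda>i. \<gamma> (i + p) ^ k) * transpose_mat Xperp * H * Xk 0
                 * minv (transpose_mat Xp * H * Xk 0) * diagm p (\<lambda>i. 1 / \<gamma> i ^ k))"
  defines "eps \<equiv> (\<lambda>k. mnorm (transpose_mat Xperp * H * Xhat k))"
  shows "\<forall>k.
     (\<exists>N W. N \<in> carrier_mat p p \<and> sym_pos_def N \<and>
            N * N * (1\<^sub>m p + transpose_mat (E k) * E k) = 1\<^sub>m p \<and>
            W \<in> carrier_mat p p \<and> orthonormal_cols W \<and>
            Xhat k = (Xp + Xperp * E k) * N * W)
   \<and> mnorm (E k) \<le> (\<gamma> p / \<gamma> (p - 1)) ^ k * mnorm (E 0)
   \<and> eps k = mnorm (E k) / sqrt (1 + (mnorm (E k))\<^sup>2)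
   \<and> eps k \<le> (\<gamma> p / \<gamma> (p - 1)) ^ k * mnorm (E 0)
   \<and> (\<forall>\<pi>. bij_betw \<pi> {..<p} {..<p} \<and>
          (\<forall>i<p. \<forall>j<p. c i < c j \<longrightarrow> ch k (\<pi> i) \<le> ch k (\<pi> j)) \<longrightarrow>
          (\<forall>i<ngv. chordal_e (sqratio (ch k (\<pi> i)) (sh k (\<pi> i))) (sqratio (c i) (s i))
                     \<le> 6 * (eps k)\<^sup>2 + 2 * (eps k)^4))"
proof -
  note QR = QR[rule_format] and GSVDk = GSVDk[rule_format]
  interpret it: gsvd_subspace_iteration
    "A\<^sup>T * A" "B\<^sup>T * B" H X P n p d c s \<gamma> cmin cmax Xk Xhat ch sh
  proof
    show "X\<^sup>T * (A\<^sup>T * A) * X = diagm n (\<lambda>i. (c i)\<^sup>2)" by (rule gsvd_gram[OF A X(1) U SA])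
    show "X\<^sup>T * (B\<^sup>T * B) * X = diagm n (\<lambda>i. (s i)\<^sup>2)" by (rule gsvd_gram[OF B X(1) V SB])
    show "(Xhat k)\<^sup>T * (A\<^sup>T * A) * Xhat k = diagm p (\<lambda>i. (ch k i)\<^sup>2)" for k
      unfolding Xhat_def using QR[of k] QRA GSVDk[of k]
      by (intro ritz_gram[OF A, of _ p "Q1 k" "Abar k" "Ubar k"]) auto
    show "(Xhat k)\<^sup>T * (B\<^sup>T * B) * Xhat k = diagm p (\<lambda>i. (sh k i)\<^sup>2)" for k
      unfolding Xhat_def using QR[of k] QRB GSVDk[of k]
      by (intro ritz_gram[OF B, of _ p "Q2 k" "Bbar k" "Vbar k"]) auto
    show "Xhat k \<in> carrier_mat n p" for k
      unfolding Xhat_def using QR GSVDk by (blast intro: mult_carrier_mat)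
    show "\<exists>R'\<in>carrier_mat p p. Xk k = Xhat k * R'" for k
      unfolding Xhat_def using QR[of k] GSVDk[of k]
        mult_invertible_range[of "Q k" n p "Xbar k" "R k"] by simp
    show "\<gamma> i \<le> \<gamma> p" if "p \<le> i" "i < n" for i using dec3 p that by auto
  qed (use A B X cs interval p gap gamma_p_min X0 X0nonsing GSVDk iter in
      \<open>auto simp: H_def S_def P_def \<gamma>_def Xp_def Xhat_def\<close>)
  have E: "E = it.E" by (simp add: fun_eq_iff E_def it.E_def Xp_def Xperp_def)
  have relax: "2 * x\<^sup>2 \<le> 6 * x\<^sup>2 + 2 * x ^ 4" for x :: real by simp
  note chordal = order_trans[OF it.chordal_ritz_value_le relax, OF _ _ less_le_trans[OF _ p(1)]]
  show ?thesis
    using it.Xhat_factorization it.mnorm_E_le it.subspace_dist_eq it.subspace_dist_le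
    unfolding E eps_def Xp_def Xperp_def by (blast intro: chordal)
qed

end
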